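(* Let $f$ be a locally univalent meromorphic function in the unit disk $\mathbb{D}=\{z\in\mathbb{C}:|z|<1\}$ whose only pole is a simple pole at the origin, with expansion $f(z)=\frac1z+b_0+b_1z+\cdots$ at $0$. Define $$\varphi(z)=\frac{zf''(z)+2f'(z)}{z^3f''(z)},\qquad \Phi(z)=\frac{\overline{z}-z\varphi(z)}{1-z^2\varphi(z)}.$$ Then $f\in Co(0)$ if and only if $$|Sf(z)|(1-|z|^2)^2+2\bigl(2|\varphi(z)|+1\bigr)|\Phi(z)|^2\leq 2\bigl(2|\varphi(z)|+1\bigr)$$ for all $z\in\mathbb{D}$ at which $\varphi(z)$ is finite.
   Context: The class $Co(0)$ consists of the univalent meromorphic functions $f$ in $\mathbb{D}$ with a simple pole at the origin, normalized by $f(z)=\frac1z+b_0+b_1z+\cdots$, that are concave, i.e. the omitted set $\mathbb{C}\setminus f(\mathbb{D}\setminus\{0\})$ is convex (equivalently, the complement of $f(\mathbb{D})$ in the Riemann sphere is a compact convex subset of $\mathbb{C}$). Locally univalent means $f'\neq0$ on $\mathbb{D}\setminus\{0\}$. The function $\varphi$ is meromorphic in $\mathbb{D}$ with a removable singularity at $0$, and removable singularities are understood to be filled in. The Schwarzian derivative is $$Sf=\left(\frac{f''}{f'}\right)'-\frac12\left(\frac{f''}{f'}\right)^2,$$ which, for $f$ meromorphic and locally univalent in $\mathbb{D}$ whose only pole is a simple pole at the origin with $f(z)=\frac1z+b_0+b_1z+\cdots$, extends holomorphically to $z=0$. *)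

theory Defs
  imports "HOL-Complex_Analysis.Complex_Analysis"
begin

(* Functions meromorphic in the unit disk whose only pole is a simple pole at the origin with
   f(z) = 1/z + b_0 + b_1 z + ... there.  The value f 0 (like the values outside the disk) is a
   dummy: neither this nor any later definition depends on it. *)
definition normalized_pole_at_0 :: "(complex \<Rightarrow> complex) \<Rightarrow> bool" where
  "normalized_pole_at_0 f \<longleftrightarrow>
     f holomorphic_on ball 0 1 - {0} \<and>
     (\<exists>b :: complex fps. f has_laurent_expansion (fls_X_inv + fps_to_fls b))"

(* Univalence of f as a map from the disk to the Riemann sphere is injectivity on the punctured
   disk, since the value infinity is attained only at the pole 0. *)
definition Co0 :: "(complex \<Rightarrow> complex) set" where
  "Co0 = {f. normalized_pole_at_0 f \<and> inj_on f (ball 0 1 - {0}) \<and>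
             convex (- (f ` (ball 0 1 - {0})))}"

(* remove_sings fills in removable singularities; here this matters at the origin only. *)
definition Schwarzian :: "(complex \<Rightarrow> complex) \<Rightarrow> complex \<Rightarrow> complex" where
  "Schwarzian f = remove_sings (\<lambda>z.
     deriv (\<lambda>w. deriv (deriv f) w / deriv f w) z - 1 / 2 * (deriv (deriv f) z / deriv f z)\<^sup>2)"

definition phi :: "(complex \<Rightarrow> complex) \<Rightarrow> complex \<Rightarrow> complex" where
  "phi f = remove_sings (\<lambda>z.
     (z * deriv (deriv f) z + 2 * deriv f z) / (z ^ 3 * deriv (deriv f) z))"

(* For f as in normalized_pole_at_0 with f' nonvanishing, the denominator is nonzero wherever
   phi f is finite: it is 1 at the origin and -2 f'(z) / (z f''(z)) elsewhere. *)
definition Phi :: "(complex \<Rightarrow> complex) \<Rightarrow> complex \<Rightarrow> complex" where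
  "Phi f z = (cnj z - z * phi f z) / (1 - z\<^sup>2 * phi f z)"

end

theory Submission
  imports Defs
begin

text \<open>
  Write \<open>P(z) = -1 - z f''(z) / f'(z)\<close>, with \<open>P(0) = 1\<close>. Then \<open>z\<^sup>2 \<phi>(z) = (P(z) - 1) / (P(z) + 1)\<close>,
  so \<open>Re P > 0\<close> says that \<open>z\<^sup>2 \<phi>(z)\<close> lies in the disk, and by the maximum principle this is the
  same as \<open>\<bar>\<phi>\<bar> \<le> 1\<close>. The proof has two independent halves: \<open>f\<close> is concave if and only if
  \<open>\<bar>\<phi>\<bar> \<le> 1\<close>, and \<open>\<bar>\<phi>\<bar> \<le> 1\<close> if and only if the stated inequality holds.

  \<^emph>\<open>The inequality.\<close> One computes \<open>Sf = -2 (3 \<phi> + z \<phi>') / (1 - z\<^sup>2 \<phi>)\<^sup>2\<close> and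
  \<open>1 - \<bar>\<Phi>\<bar>\<^sup>2 = (1 - \<bar>z\<bar>\<^sup>2) (1 - \<bar>z \<phi>\<bar>\<^sup>2) / \<bar>1 - z\<^sup>2 \<phi>\<bar>\<^sup>2\<close>, so that the inequality reads
  \<open>\<bar>3 \<phi> + z \<phi>'\<bar> (1 - \<bar>z\<bar>\<^sup>2) \<le> (2 \<bar>\<phi>\<bar> + 1) (1 - \<bar>z \<phi>\<bar>\<^sup>2)\<close>. If \<open>\<bar>\<phi>\<bar> \<le> 1\<close>, this follows from the
  Schwarz--Pick bound on \<open>\<phi>'\<close>. Conversely its right-hand side must be nonnegative, so
  \<open>\<bar>z \<phi>\<bar> \<le> 1\<close> wherever \<open>\<phi>\<close> is finite; hence \<open>\<phi>\<close> has no poles, and the maximum principle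
  improves the bound to \<open>\<bar>\<phi>\<bar> \<le> 1\<close>.

  \<^emph>\<open>Concavity.\<close> Both directions pass through the tangent lines of the image curves of the circles
  \<open>\<bar>z\<bar> = r\<close>: the image curve lies on one side of its tangent at \<open>f z0\<close> when
  \<open>Re ((f z - f z0) / (z0 f' z0)) \<ge> 0\<close> for all \<open>\<bar>z\<bar> = \<bar>z0\<bar>\<close>. The speed at which the tangent
  direction turns along the curve is \<open>- Re P\<close>. If \<open>Re P > 0\<close>, the direction turns monotonically and
  exactly once around, and the curve stays on one side of each of its tangents
  (\<open>curve_on_one_side_of_tangent\<close>). Hence \<open>f\<close> is injective on circles, which by openness already
  forces injectivity (\<open>inj_on_if_inj_on_circles\<close>), and the tangents are supporting lines of the
  complement of the image of \<open>\<bar>z\<bar> < r\<close>, which is therefore convex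
  (\<open>convex_complement_if_curves_on_one_side\<close>). Conversely, if \<open>f\<close> is injective and omits a convex
  set, a Schwarz-type argument compares \<open>s\<close> with the preimage \<open>h(s)\<close> of a convex combination of
  \<open>f(a s)\<close> and \<open>f(b s)\<close>, \<open>\<bar>a\<bar> = \<bar>b\<bar> = 1\<close>: one has \<open>\<bar>h(s)\<bar> \<ge> \<bar>s\<bar>\<close>
  (\<open>modulus_le_modulus_preimage_convex_combination\<close>). To first order in the weight this is the
  tangent property, and the tangent property gives \<open>Re P \<ge> 0\<close> (\<open>angular_speed_nonneg\<close>).
\<close>

section \<open>Normal form of the derivative\<close>

lemma normalized_pole_split:
  assumes "normalized_pole_at_0 f"
  obtains g where "g holomorphic_on ball 0 1" "\<And>z. z \<in> ball 0 1 - {0} \<Longrightarrow> f z = 1 / z + g z"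
proof -
  obtain b :: "complex fps" where hol: "f holomorphic_on ball 0 1 - {0}"
    and b: "f has_laurent_expansion (fls_X_inv + fps_to_fls b)"
    using assms unfolding normalized_pole_at_0_def by blast
  have "(\<lambda>z. f z - inverse z) has_laurent_expansion (fls_X_inv + fps_to_fls b) - inverse fls_X"
    by (intro laurent_expansion_intros b)
  then have "(\<lambda>z. f z - inverse z) has_laurent_expansion fps_to_fls b"
    by (simp add: fls_inverse_X)
  then have lim: "(\<lambda>z. f z - inverse z) \<midarrow>0\<rightarrow> fls_nth (fps_to_fls b) 0"
    by (rule has_laurent_expansion_imp_tendsto_0) (simp add: fls_subdegree_fls_to_fps_gt0)
  have "(\<lambda>z. if z = 0 then fls_nth (fps_to_fls b) 0 else f z - inverse z) holomorphic_on ball 0 1"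
    by (rule removable_singularity[OF _ _ lim]) (auto intro!: holomorphic_intros hol)
  then show thesis
    by (rule that) (auto simp: field_simps)
qed

text \<open>
  Since \<open>f'\<close> has a double pole without residue at the origin and no zeros, \<open>- z\<^sup>2 f'(z)\<close> extends to a
  zero-free function \<open>exp q\<close> with \<open>q'(0) = 0\<close>. Everything is expressed through \<open>q\<close> and
  \<open>p = q' / z\<close>: in particular \<open>P(z) = -1 - z f''(z) / f'(z) = 1 - z q'(z) = 1 - z\<^sup>2 p(z)\<close>, which
  removes the singularity at the origin from all later computations.
\<close>

lemma deriv_eq_minus_exp_over_square:
  assumes g: "g holomorphic_on ball 0 1"
    and fg: "\<And>z. z \<in> ball 0 1 - {0} \<Longrightarrow> f z = 1 / z + g z"
    and nz: "\<And>z. z \<in> ball 0 1 - {0} \<Longrightarrow> deriv f z \<noteq> 0"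
  obtains q p where "q holomorphic_on ball 0 1" "p holomorphic_on ball 0 1"
    "\<And>z. z \<in> ball 0 1 \<Longrightarrow> deriv q z = z * p z"
    "\<And>z. z \<in> ball 0 1 - {0} \<Longrightarrow> deriv f z = - exp (q z) / z\<^sup>2"
proof -
  define N where "N z = 1 - z\<^sup>2 * deriv g z" for z
  have g': "deriv g holomorphic_on ball 0 1" and g'': "deriv (deriv g) holomorphic_on ball 0 1"
    using g by (auto intro!: holomorphic_deriv)
  have N: "N holomorphic_on ball 0 1"
    unfolding N_def by (intro holomorphic_intros g')
  have f': "deriv f z = - N z / z\<^sup>2" if z: "z \<in> ball 0 1 - {0}" for z
  proof -
    have "((\<lambda>w. 1 / w + g w) has_field_derivative - 1 / z\<^sup>2 + deriv g z) (at z)"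
      using z by (auto intro!: derivative_eq_intros holomorphic_derivI[OF g] simp: power2_eq_square)
    then have "(f has_field_derivative - 1 / z\<^sup>2 + deriv g z) (at z)"
      by (rule has_field_derivative_transform_within_open[of _ _ _ "ball 0 1 - {0}"]) (use z fg in auto)
    then show ?thesis
      using z unfolding N_def by (auto simp: field_simps dest!: DERIV_imp_deriv)
  qed
  have N0: "N z \<noteq> 0" if "z \<in> ball 0 1" for z
  proof (cases "z = 0")
    case False
    then show ?thesis using f'[of z] nz[of z] that by auto
  qed (simp add: N_def)
  obtain q where q: "q holomorphic_on ball 0 1" and Nq: "\<And>z. z \<in> ball 0 1 \<Longrightarrow> N z = exp (q z)"
    using contractible_imp_holomorphic_log[OF N convex_imp_contractible N0] by auto
  define p where "p z = - (2 * deriv g z + z * deriv (deriv g) z) / N z" for z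
  have p: "p holomorphic_on ball 0 1"
    unfolding p_def by (intro holomorphic_intros g' g'' N N0)
  have q': "deriv q z = z * p z" if z: "z \<in> ball 0 1" for z
  proof -
    have "((\<lambda>w. exp (q w)) has_field_derivative exp (q z) * deriv q z) (at z)"
      by (auto intro!: derivative_eq_intros holomorphic_derivI[OF q _ z])
    then have "(N has_field_derivative exp (q z) * deriv q z) (at z)"
      by (rule has_field_derivative_transform_within_open[of _ _ _ "ball 0 1"]) (use z Nq in auto)
    moreover have "(N has_field_derivative - (2 * z * deriv g z + z\<^sup>2 * deriv (deriv g) z)) (at z)"
      unfolding N_def by (auto intro!: derivative_eq_intros holomorphic_derivI[OF g' _ z])
    ultimately have "exp (q z) * deriv q z = - (2 * z * deriv g z + z\<^sup>2 * deriv (deriv g) z)"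
      by (rule DERIV_unique)
    then show ?thesis
      unfolding p_def Nq[OF z] by (simp add: field_simps power2_eq_square)
  qed
  show thesis
    by (rule that[OF q p q']) (use f' Nq in auto)
qed

section \<open>Turning of the tangent along the images of circles\<close>

text \<open>
  Along the circle through \<open>z0\<close>, \<open>u\<close> is the signed distance (up to a positive factor) of the image
  curve from its tangent at \<open>f z0\<close>, and \<open>- \<psi>\<close> is the continuous angle through which the tangent
  direction has turned since \<open>z0\<close>. It is available in closed form because \<open>z f'(z)\<close> is
  \<open>- exp (q z) / z\<close>; the factor \<open>1 / z\<close> contributes the term \<open>t\<close>.
\<close>

lemma circle_derivatives:
  fixes z0 :: complex and f q :: "complex \<Rightarrow> complex"
  defines "u \<equiv> \<lambda>t. Re ((f (z0 * cis t) - f z0) / (z0 * deriv f z0))"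
    and "\<psi> \<equiv> \<lambda>t. t - Im (q (z0 * cis t) - q z0)"
  assumes f: "f holomorphic_on ball 0 1 - {0}" and q: "q holomorphic_on ball 0 1"
    and f': "\<And>z. z \<in> ball 0 1 - {0} \<Longrightarrow> deriv f z = - exp (q z) / z\<^sup>2"
    and z0: "z0 \<in> ball 0 1 - {0}"
  shows "(u has_real_derivative exp (Re (q (z0 * cis t) - q z0)) * sin (\<psi> t)) (at t)"
    and "(\<psi> has_real_derivative Re (1 - z0 * cis t * deriv q (z0 * cis t))) (at t)"
proof -
  define z where "z = z0 * cis t"
  have z: "z \<in> ball 0 1 - {0}"
    using z0 by (auto simp: z_def norm_mult)
  have path: "((\<lambda>t. z0 * cis t) has_vector_derivative \<i> * z) (at t)"
    unfolding z_def by (auto intro!: derivative_eq_intros simp: has_vector_derivative_def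
        scaleR_conv_of_real mult_ac)
  have "((f \<circ> (\<lambda>t. z0 * cis t)) has_vector_derivative (\<i> * z) * deriv f z) (at t)"
    by (rule field_vector_diff_chain_at[OF path]) 
       (use z in \<open>auto intro!: holomorphic_derivI[OF f] simp: z_def[symmetric]\<close>)
  then have "((\<lambda>t. f (z0 * cis t)) has_vector_derivative \<i> * z * deriv f z) (at t)"
    by (simp add: o_def)
  then have "((\<lambda>t. (f (z0 * cis t) - f z0) / (z0 * deriv f z0)) has_vector_derivative
      (\<i> * z * deriv f z) / (z0 * deriv f z0)) (at t)"
    by (auto intro!: derivative_eq_intros has_vector_derivative_divide)
  then have "(u has_real_derivative Re ((\<i> * z * deriv f z) / (z0 * deriv f z0))) (at t)"
    unfolding u_def by (rule has_field_derivative_Re)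
  moreover have "(\<i> * z * deriv f z) / (z0 * deriv f z0) = \<i> * exp (q z - q z0 - \<i> * t)"
  proof -
    have "(\<i> * z * deriv f z) / (z0 * deriv f z0) = \<i> * (exp (q z) / exp (q z0)) * (z0 / z)"
      using z z0 unfolding f'[OF z] f'[OF z0] by (simp add: divide_simps power2_eq_square)
    also have "z0 / z = exp (- (\<i> * t))"
      using z0 by (simp add: z_def cis_conv_exp exp_minus divide_simps)
    finally show ?thesis
      by (simp add: exp_diff exp_minus divide_simps)
  qed
  moreover have "Re (\<i> * exp (q z - q z0 - \<i> * t)) = exp (Re (q z - q z0)) * sin (\<psi> t)"
    by (simp add: Im_exp \<psi>_def z_def sin_diff algebra_simps flip: sin_minus)
  ultimately show "(u has_real_derivative exp (Re (q (z0 * cis t) - q z0)) * sin (\<psi> t)) (at t)"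
    by (simp add: z_def)
  have "((q \<circ> (\<lambda>t. z0 * cis t)) has_vector_derivative (\<i> * z) * deriv q z) (at t)"
    by (rule field_vector_diff_chain_at[OF path]) 
       (use z in \<open>auto intro!: holomorphic_derivI[OF q] simp: z_def[symmetric]\<close>)
  then have "((\<lambda>t. q (z0 * cis t) - q z0) has_vector_derivative \<i> * z * deriv q z) (at t)"
    by (auto intro!: derivative_eq_intros simp: o_def)
  from DERIV_diff[OF DERIV_ident has_field_derivative_Im[OF this]]
  show "(\<psi> has_real_derivative Re (1 - z0 * cis t * deriv q (z0 * cis t))) (at t)"
    unfolding \<psi>_def by (rule DERIV_cong) (simp add: z_def algebra_simps)
qed

text \<open>
  The derivative of \<open>u\<close> has the sign of \<open>sin \<psi>\<close>, and \<open>\<psi>\<close> increases from \<open>0\<close> to \<open>2 pi\<close>. So \<open>u\<close>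
  rises from \<open>u 0 = 0\<close> while \<open>\<psi> \<le> pi\<close> and then falls to \<open>u (2 pi) = 0\<close>; it is positive in between.
\<close>

lemma curve_on_one_side_of_tangent:
  fixes f q :: "complex \<Rightarrow> complex"
  assumes f: "f holomorphic_on ball 0 1 - {0}" and q: "q holomorphic_on ball 0 1"
    and f': "\<And>z. z \<in> ball 0 1 - {0} \<Longrightarrow> deriv f z = - exp (q z) / z\<^sup>2"
    and pos: "\<And>z. z \<in> ball 0 1 \<Longrightarrow> Re (1 - z * deriv q z) > 0"
    and z0: "z0 \<in> ball 0 1 - {0}" and z: "norm z = norm z0" "z \<noteq> z0"
  shows "Re ((f z - f z0) / (z0 * deriv f z0)) > 0"
proof -
  define u where "u t = Re ((f (z0 * cis t) - f z0) / (z0 * deriv f z0))" for t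
  define \<psi> where "\<psi> t = t - Im (q (z0 * cis t) - q z0)" for t
  note D = circle_derivatives[OF f q f' z0, folded u_def \<psi>_def]
  have u_deriv: "(u has_real_derivative exp (Re (q (z0 * cis t) - q z0)) * sin (\<psi> t)) (at t)" for t
    using D(1) unfolding u_def[abs_def] \<psi>_def[abs_def] .
  have \<psi>_deriv: "(\<psi> has_real_derivative Re (1 - z0 * cis t * deriv q (z0 * cis t))) (at t)" for t
    using D(2) unfolding \<psi>_def[abs_def] .
  have cont: "continuous_on A u" for A
    by (rule DERIV_continuous_on) (blast intro: has_field_derivative_at_within u_deriv)
  have \<psi>_mono: "\<psi> s < \<psi> t" if "s < t" for s t
  proof (rule DERIV_pos_imp_increasing[OF that])
    fix x
    have "z0 * cis x \<in> ball 0 1" using z0 by (auto simp: norm_mult)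
    from \<psi>_deriv[of x] pos[OF this] show "\<exists>y. (\<psi> has_real_derivative y) (at x) \<and> 0 < y"
      by blast
  qed
  have ends: "\<psi> 0 = 0" "\<psi> (2 * pi) = 2 * pi" "u 0 = 0" "u (2 * pi) = 0"
    by (simp_all add: \<psi>_def u_def)
  define t where "t = Arg2pi (z / z0)"
  have "z / z0 = exp (\<i> * of_real t)"
    using Arg2pi_eq[of "z / z0"] z z0 by (simp add: t_def norm_divide)
  then have zt: "z = z0 * cis t"
    using z0 by (auto simp: cis_conv_exp field_simps)
  have t: "0 < t" "t < 2 * pi"
  proof -
    have "t \<noteq> 0" using zt z by auto
    then show "0 < t" "t < 2 * pi"
      using Arg2pi_ge_0[of "z / z0"] Arg2pi_lt_2pi[of "z / z0"] unfolding t_def by linarith+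
  qed
  have "u t > 0"
  proof (cases "\<psi> t \<le> pi")
    case True
    have "u 0 < u t"
    proof (rule DERIV_pos_imp_increasing_open[OF t(1) _ cont])
      fix x assume x: "0 < x" "x < t"
      then have "sin (\<psi> x) > 0"
        using \<psi>_mono[of 0 x] \<psi>_mono[of x t] True ends by (intro sin_gt_zero) auto
      with u_deriv[of x] show "\<exists>y. (u has_real_derivative y) (at x) \<and> 0 < y"
        by (intro exI[of _ "exp (Re (q (z0 * cis x) - q z0)) * sin (\<psi> x)"]) auto
    qed
    then show ?thesis using ends by simp
  next
    case False
    have "u (2 * pi) < u t"
    proof (rule DERIV_neg_imp_decreasing_open[OF t(2) _ cont])
      fix x assume x: "t < x" "x < 2 * pi"
      then have "sin (\<psi> x) < 0"
        using \<psi>_mono[of t x] \<psi>_mono[of x "2 * pi"] False ends by (intro sin_lt_zero) auto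
      with u_deriv[of x] show "\<exists>y. (u has_real_derivative y) (at x) \<and> y < 0"
        by (intro exI[of _ "exp (Re (q (z0 * cis x) - q z0)) * sin (\<psi> x)"]) (auto simp: mult_pos_neg)
    qed
    then show ?thesis using ends by simp
  qed
  then show ?thesis by (simp add: u_def zt)
qed

text \<open>
  The infinitesimal converse: if \<open>\<psi>\<close> decreased at \<open>0\<close>, then \<open>u\<close> would become negative immediately
  after \<open>0\<close>.
\<close>

lemma angular_speed_nonneg:
  fixes f q :: "complex \<Rightarrow> complex"
  assumes f: "f holomorphic_on ball 0 1 - {0}" and q: "q holomorphic_on ball 0 1"
    and f': "\<And>z. z \<in> ball 0 1 - {0} \<Longrightarrow> deriv f z = - exp (q z) / z\<^sup>2"
    and z0: "z0 \<in> ball 0 1 - {0}"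
    and side: "\<And>z. norm z = norm z0 \<Longrightarrow> Re ((f z - f z0) / (z0 * deriv f z0)) \<ge> 0"
  shows "Re (1 - z0 * deriv q z0) \<ge> 0"
proof (rule ccontr)
  assume neg: "\<not> ?thesis"
  define u where "u t = Re ((f (z0 * cis t) - f z0) / (z0 * deriv f z0))" for t
  define \<psi> where "\<psi> t = t - Im (q (z0 * cis t) - q z0)" for t
  note D = circle_derivatives[OF f q f' z0, folded u_def \<psi>_def]
  have u_deriv: "(u has_real_derivative exp (Re (q (z0 * cis t) - q z0)) * sin (\<psi> t)) (at t)" for t
    using D(1) unfolding u_def[abs_def] \<psi>_def[abs_def] .
  have \<psi>_deriv: "(\<psi> has_real_derivative Re (1 - z0 * deriv q z0)) (at 0)"
    using D(2)[of 0] unfolding \<psi>_def[abs_def] by simp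
  have [simp]: "\<psi> 0 = 0" "u 0 = 0"
    by (simp_all add: \<psi>_def u_def)
  obtain d where d: "d > 0" "\<And>h. 0 < h \<Longrightarrow> h < d \<Longrightarrow> \<psi> h < 0"
    using DERIV_neg_dec_right[OF \<psi>_deriv] neg by auto
  have "(\<psi> \<longlongrightarrow> 0) (at 0)"
    using DERIV_isCont[OF \<psi>_deriv] by (simp add: isCont_def)
  then have "\<forall>\<^sub>F t in at 0. - pi < \<psi> t"
    by (rule order_tendstoD) simp
  then obtain e where e: "e > 0" "\<And>t. t \<noteq> 0 \<Longrightarrow> dist t 0 < e \<Longrightarrow> - pi < \<psi> t"
    unfolding eventually_at by auto
  define b where "b = min d e / 2"
  have b: "0 < b" "b < d" "b < e" using d e by (auto simp: b_def)
  have cont: "continuous_on A u" for A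
    by (rule DERIV_continuous_on) (blast intro: has_field_derivative_at_within u_deriv)
  have "u b < u 0"
  proof (rule DERIV_neg_imp_decreasing_open[OF b(1) _ cont])
    fix x assume x: "0 < x" "x < b"
    have "sin (\<psi> x) < 0"
      using d(2)[of x] e(2)[of x] x b sin_gt_zero[of "- \<psi> x"] by auto
    with u_deriv[of x] show "\<exists>y. (u has_real_derivative y) (at x) \<and> y < 0"
      by (intro exI[of _ "exp (Re (q (z0 * cis x) - q z0)) * sin (\<psi> x)"]) (auto simp: mult_pos_neg)
  qed
  moreover have "u b \<ge> 0"
    unfolding u_def by (rule side) (simp add: norm_mult)
  ultimately show False by simp
qed

section \<open>Behaviour at the pole\<close>

text \<open>
  Properness of \<open>f\<close> on the disk as a map to the sphere: a finite limit of values excludes the pole as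
  limit of the arguments. Multiplying by \<open>x n\<close> turns \<open>f\<close> into a continuous function, equal to
  \<open>1\<close> at the origin.
\<close>

lemma limit_of_values:
  fixes f g :: "complex \<Rightarrow> complex"
  assumes g: "g holomorphic_on ball 0 1"
    and fg: "\<And>z. z \<in> ball 0 1 - {0} \<Longrightarrow> f z = 1 / z + g z"
    and x: "\<And>n. x n \<in> ball 0 1 - {0}" "x \<longlonglongrightarrow> \<zeta>" and \<zeta>: "\<zeta> \<in> ball 0 1"
    and w: "(\<lambda>n. f (x n)) \<longlonglongrightarrow> w"
  shows "\<zeta> \<noteq> 0 \<and> f \<zeta> = w"
proof -
  have gx: "(\<lambda>n. g (x n)) \<longlonglongrightarrow> g \<zeta>"
  proof (rule continuous_on_tendsto_compose[OF holomorphic_on_imp_continuous_on[OF g]])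
    show "\<forall>\<^sub>F n in sequentially. x n \<in> ball 0 1"
      using x(1) by (intro always_eventually) auto
  qed (use x \<zeta> in auto)
  have eq: "(\<lambda>n. x n * f (x n)) = (\<lambda>n. 1 + x n * g (x n))"
  proof
    fix n show "x n * f (x n) = 1 + x n * g (x n)"
      using x(1)[of n] fg[OF x(1)[of n]] by (simp add: distrib_left)
  qed
  have "(\<lambda>n. x n * f (x n)) \<longlonglongrightarrow> \<zeta> * w"
    by (intro tendsto_intros x w)
  moreover have "(\<lambda>n. x n * f (x n)) \<longlonglongrightarrow> 1 + \<zeta> * g \<zeta>"
    unfolding eq by (intro tendsto_intros x gx)
  ultimately have *: "\<zeta> * w = 1 + \<zeta> * g \<zeta>"
    by (rule LIMSEQ_unique)
  show ?thesis
  proof (cases "\<zeta> = 0")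
    case False
    then have "\<zeta> * f \<zeta> = 1 + \<zeta> * g \<zeta>"
      using fg[of \<zeta>] \<zeta> by (simp add: distrib_left)
    with * False show ?thesis by (metis mult_left_cancel)
  qed (use * in simp)
qed

text \<open>
  The open mapping theorem at the pole, applied to the reciprocal \<open>F\<close> of \<open>f\<close>.
\<close>

lemma eventually_covers_neighbourhood_of_infinity:
  fixes f g :: "complex \<Rightarrow> complex"
  assumes g: "g holomorphic_on ball 0 1"
    and fg: "\<And>z. z \<in> ball 0 1 - {0} \<Longrightarrow> f z = 1 / z + g z"
    and r: "0 < r" "r \<le> 1"
  obtains M where "\<And>w. norm w > M \<Longrightarrow> w \<in> f ` (ball 0 r - {0})"
proof -
  have contg: "continuous_on (ball 0 1) g"
    using g by (rule holomorphic_on_imp_continuous_on)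
  have "isCont (\<lambda>z. 1 + z * g z) 0"
    using contg by (intro continuous_intros) (simp add: continuous_on_eq_continuous_at)
  then have "(\<lambda>z. 1 + z * g z) \<midarrow>0\<rightarrow> 1" by (simp add: isCont_def)
  then have "\<forall>\<^sub>F z in at 0. 1 + z * g z \<noteq> 0"
    by (rule tendsto_imp_eventually_ne) simp
  then obtain d where d: "d > 0" "\<And>z. z \<noteq> 0 \<Longrightarrow> dist z 0 < d \<Longrightarrow> 1 + z * g z \<noteq> 0"
    unfolding eventually_at by auto
  define e where "e = min d r"
  have e: "0 < e" "e \<le> r" "e \<le> d" using d r by (auto simp: e_def)
  have ne: "1 + z * g z \<noteq> 0" if "z \<in> ball 0 e" for z
    using d(2)[of z] that e by (cases "z = 0") auto
  define F where "F z = z / (1 + z * g z)" for z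
  have holF: "F holomorphic_on ball 0 e"
    unfolding F_def using g e r ne by (intro holomorphic_intros) (auto intro: holomorphic_on_subset)
  have "open (F ` ball 0 e)"
  proof (rule open_mapping_thm[OF holF])
    show "\<not> F constant_on ball 0 e"
    proof
      assume "F constant_on ball 0 e"
      then obtain c where "\<And>z. z \<in> ball 0 e \<Longrightarrow> F z = c" by (auto simp: constant_on_def)
      from this[of 0] this[of "of_real (e/2)"] have "F (of_real (e / 2)) = 0"
        using e by (auto simp: F_def)
      moreover have "of_real (e / 2) \<in> ball (0::complex) e"
        using e by simp
      ultimately show False
        using ne e unfolding F_def divide_eq_0_iff of_real_eq_0_iff by fastforce
    qed
  qed auto
  moreover have "0 \<in> F ` ball 0 e"
    using e by (intro image_eqI[of _ _ 0]) (auto simp: F_def)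
  ultimately obtain \<epsilon> where \<epsilon>: "\<epsilon> > 0" "ball 0 \<epsilon> \<subseteq> F ` ball 0 e"
    by (meson open_contains_ball)
  show thesis
  proof (rule that)
    fix w :: complex assume w: "norm w > 1 / \<epsilon>"
    then have w0: "norm w > 0" using \<epsilon> by (smt (verit) divide_pos_pos)
    then have "1 / w \<in> ball 0 \<epsilon>" using w \<epsilon> by (simp add: norm_divide field_simps)
    then obtain z where z: "z \<in> ball 0 e" "1 / w = F z" using \<epsilon> by blast
    have "z \<noteq> 0" using z w0 by (auto simp: F_def)
    have "w = (1 + z * g z) / z"
      using z(2) by (metis F_def inverse_divide inverse_eq_divide inverse_inverse_eq)
    also have "\<dots> = f z"
      using fg[of z] \<open>z \<noteq> 0\<close> z(1) e r by (simp add: add_divide_distrib)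
    finally have "f z = w" ..
    then show "w \<in> f ` (ball 0 r - {0})"
      using z \<open>z \<noteq> 0\<close> e by (intro image_eqI[of _ _ z]) auto
  qed
qed

section \<open>From tangent lines to concavity\<close>

text \<open>
  A partial converse of the supporting hyperplane theorem: \<open>S\<close> is the intersection \<open>T\<close> of its
  supporting half-spaces. The segment from an interior point to a point outside \<open>S\<close> meets the
  frontier, and the half-space at the crossing point contains the interior point strictly, so it
  excludes the outer end.
\<close>

lemma convex_if_supported:
  fixes S :: "'a::euclidean_space set"
  assumes "closed S" and int: "interior S \<noteq> {}"
    and supp: "\<And>x. x \<in> frontier S \<Longrightarrow> \<exists>a. a \<noteq> 0 \<and> (\<forall>y\<in>S. a \<bullet> x \<le> a \<bullet> y)"
  shows "convex S"
proof -
  obtain A where A: "\<And>x. x \<in> frontier S \<Longrightarrow> A x \<noteq> 0"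
      "\<And>x y. x \<in> frontier S \<Longrightarrow> y \<in> S \<Longrightarrow> A x \<bullet> x \<le> A x \<bullet> y"
    using supp by metis
  define T where "T = (\<Inter>x\<in>frontier S. {y. A x \<bullet> y \<ge> A x \<bullet> x})"
  have "convex T"
    unfolding T_def by (intro convex_INT) (simp add: convex_halfspace_ge)
  moreover have "S \<subseteq> T" using A by (auto simp: T_def)
  moreover have "T \<subseteq> S"
  proof
    fix w assume w: "w \<in> T"
    show "w \<in> S"
    proof (rule ccontr)
      assume wS: "w \<notin> S"
      obtain c e where c: "e > 0" "cball c e \<subseteq> S"
        using int by (auto simp: mem_interior_cball)
      then have cS: "c \<in> S" by (meson centre_in_cball less_imp_le subsetD)
      have "closed_segment c w \<inter> frontier S \<noteq> {}"
        by (rule connected_Int_frontier) (use wS cS in auto)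
      then obtain x where x: "x \<in> closed_segment c w" "x \<in> frontier S" by blast
      then obtain t where t: "0 \<le> t" "t \<le> 1" "x = (1 - t) *\<^sub>R c + t *\<^sub>R w"
        by (auto simp: closed_segment_def)
      have "x \<noteq> w" using x(2) wS \<open>closed S\<close> frontier_subset_closed by blast
      then have t1: "t < 1" using t by (cases "t = 1") auto
      have "c - (e / norm (A x)) *\<^sub>R A x \<in> cball c e"
        using c A(1)[OF x(2)] by (simp add: dist_norm)
      then have "A x \<bullet> x \<le> A x \<bullet> (c - (e / norm (A x)) *\<^sub>R A x)"
        using A(2)[OF x(2)] c by blast
      also have "\<dots> < A x \<bullet> c"
        using A(1)[OF x(2)] c by (simp add: inner_diff_right)
      finally have "(1 - t) * (A x \<bullet> x) < (1 - t) * (A x \<bullet> c)"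
        using t1 by simp
      moreover have "t * (A x \<bullet> x) \<le> t * (A x \<bullet> w)"
        using w x(2) t by (intro mult_left_mono) (auto simp: T_def)
      moreover have "A x \<bullet> x = (1 - t) * (A x \<bullet> c) + t * (A x \<bullet> w)"
        by (subst (2) t(3)) (simp add: inner_add_right)
      ultimately show False by (simp add: algebra_simps)
    qed
  qed
  ultimately show ?thesis by (metis subset_antisym)
qed

text \<open>
  Take a collision \<open>f z = f w\<close>, \<open>z \<noteq> w\<close>, for which the larger modulus is minimal. Such a minimum
  exists because the pole keeps collisions away from the origin and the nonvanishing derivative
  keeps them away from the diagonal, so that they form a compact set \<open>C\<close>. By assumption the two
  moduli differ. But then the point of larger modulus can be moved towards the origin, and by
  openness of \<open>f\<close> at the other point the collision persists: a contradiction.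
\<close>

lemma inj_on_if_inj_on_circles:
  fixes f g :: "complex \<Rightarrow> complex"
  assumes f: "f holomorphic_on ball 0 1 - {0}" and g: "g holomorphic_on ball 0 1"
    and fg: "\<And>z. z \<in> ball 0 1 - {0} \<Longrightarrow> f z = 1 / z + g z"
    and nz: "\<And>z. z \<in> ball 0 1 - {0} \<Longrightarrow> deriv f z \<noteq> 0"
    and circ: "\<And>z w. z \<in> ball 0 1 - {0} \<Longrightarrow> norm w = norm z \<Longrightarrow> w \<noteq> z \<Longrightarrow> f w \<noteq> f z"
  shows "inj_on f (ball 0 1 - {0})"
proof (rule ccontr)
  let ?D = "ball (0::complex) 1 - {0}"
  assume "\<not> ?thesis"
  then obtain a b where ab: "a \<in> ?D" "b \<in> ?D" "f a = f b" "a \<noteq> b"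
    unfolding inj_on_def by blast
  define R where "R = max (norm a) (norm b)"
  have R: "R < 1" using ab by (auto simp: R_def)
  have D: "open ?D" by auto
  have contf: "continuous_on ?D f" using f by (rule holomorphic_on_imp_continuous_on)
  have "continuous_on (cball 0 R) (deriv g)"
    using holomorphic_deriv[OF g] R
    by (intro holomorphic_on_imp_continuous_on) (auto intro: holomorphic_on_subset)
  then have "compact (deriv g ` cball 0 R)"
    by (rule compact_continuous_image) simp
  then obtain L where L: "L > 0" "\<And>z. z \<in> cball 0 R \<Longrightarrow> norm (deriv g z) \<le> L"
    using bounded_pos[of "deriv g ` cball 0 R"] compact_imp_bounded by auto
  \<comment> \<open>If \<open>f z = f w\<close>, then \<open>w - z = z w (g w - g z)\<close>, and \<open>g\<close> is Lipschitz on the smaller disk.\<close>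
  have apart: "1 / L \<le> norm z" if "z \<in> cball 0 R - {0}" "w \<in> cball 0 R - {0}" "f z = f w" "z \<noteq> w" for z w
  proof -
    have "norm (g z - g w) \<le> L * norm (z - w)"
    proof (rule field_differentiable_bound[of "cball 0 R" g "deriv g"])
      fix x :: complex assume "x \<in> cball 0 R"
      then have "x \<in> ball 0 1" using R by auto
      then show "(g has_field_derivative deriv g x) (at x within cball 0 R)"
        by (intro holomorphic_derivI[OF g]) auto
    qed (use that L in auto)
    moreover have "w - z = z * w * (g w - g z)"
      using that fg[of z] fg[of w] R by (auto simp: field_simps)
    then have "norm (w - z) = norm z * norm w * norm (g w - g z)"
      by (metis norm_mult)
    ultimately have "norm (w - z) \<le> norm z * norm w * (L * norm (w - z))"
      by (simp add: mult_left_mono norm_minus_commute)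
    then have "norm (w - z) * 1 \<le> norm (w - z) * (norm z * L * norm w)"
      by (simp add: mult_ac)
    then have "1 \<le> norm z * L * norm w"
      using that by (subst (asm) mult_le_cancel_left_pos) auto
    also have "\<dots> \<le> norm z * L * 1"
      using that R L by (intro mult_left_mono) auto
    finally show ?thesis using L by (simp add: field_simps)
  qed
  define A where "A = cball (0::complex) R - ball 0 (1 / L)"
  have compA: "compact A" unfolding A_def by (intro compact_diff) auto
  have AD: "A \<subseteq> ?D" using R L by (auto simp: A_def)
  have AR: "A \<subseteq> cball 0 R - {0}" using L by (auto simp: A_def)
  have "\<exists>r>0. inj_on f (ball z r)" if "z \<in> ?D" for z
    using has_complex_derivative_locally_injective[OF f that D nz[OF that]] by metis
  then obtain \<rho> where \<rho>: "\<And>z. z \<in> ?D \<Longrightarrow> \<rho> z > 0" "\<And>z. z \<in> ?D \<Longrightarrow> inj_on f (ball z (\<rho> z))"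
    by metis
  \<comment> \<open>\<open>W\<close> is a neighbourhood of the diagonal of \<open>A\<close> that contains no collisions.\<close>
  define W where "W = (\<Union>z\<in>A. ball z (\<rho> z) \<times> ball z (\<rho> z))"
  define C where "C = {p \<in> A \<times> A. f (fst p) - f (snd p) \<in> {0}} - W"
  have "compact {p \<in> A \<times> A. f (fst p) - f (snd p) \<in> {0}}"
  proof -
    have "continuous_on (A \<times> A) (\<lambda>p. f (fst p) - f (snd p))"
      by (intro continuous_intros continuous_on_compose2[OF contf]) (use AD in auto)
    then have "closed ((A \<times> A) \<inter> (\<lambda>p. f (fst p) - f (snd p)) -` {0})"
      by (intro continuous_closed_preimage closed_Times compact_imp_closed compA) auto
    then have "compact ((A \<times> A) \<inter> ((A \<times> A) \<inter> (\<lambda>p. f (fst p) - f (snd p)) -` {0}))"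
      by (intro compact_Int_closed compact_Times compA)
    also have "(A \<times> A) \<inter> ((A \<times> A) \<inter> (\<lambda>p. f (fst p) - f (snd p)) -` {0}) = {p \<in> A \<times> A. f (fst p) - f (snd p) \<in> {0}}"
      by blast
    finally show ?thesis .
  qed
  moreover have "open W" unfolding W_def by (intro open_UN ballI open_Times open_ball)
  ultimately have compC: "compact C" unfolding C_def by (rule compact_diff)
  have C_I: "(z, w) \<in> C" if zw: "z \<in> cball 0 R - {0}" "w \<in> cball 0 R - {0}" "f z = f w" "z \<noteq> w" for z w
  proof -
    have "z \<in> A" "w \<in> A"
      using apart[OF zw] apart[OF zw(2,1) zw(3)[symmetric]] zw by (auto simp: A_def)
    moreover have "(z, w) \<notin> W"
      using zw \<rho>(2) AD unfolding W_def inj_on_def by blast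
    ultimately show ?thesis using zw by (auto simp: C_def)
  qed
  have C_D: "z \<in> A \<and> w \<in> A \<and> f z = f w \<and> z \<noteq> w" if "(z, w) \<in> C" for z w
  proof -
    have "z \<in> A" "w \<in> A" "f z = f w" "(z, w) \<notin> W" using that by (auto simp: C_def)
    moreover have "(z, z) \<in> W" if "z \<in> A" for z
    proof -
      have "z \<in> ?D" using that AD by blast
      then show ?thesis using that \<rho>(1)[of z] unfolding W_def by (intro UN_I[of z]) auto
    qed
    ultimately show ?thesis by metis
  qed
  define m where "m p = max (norm (fst p)) (norm (snd p))" for p :: "complex \<times> complex"
  have "C \<noteq> {}"
    using C_I[of a b] ab by (auto simp: R_def)
  moreover have "continuous_on C m" unfolding m_def by (intro continuous_intros)
  ultimately have "\<exists>p\<in>C. \<forall>p'\<in>C. m p \<le> m p'"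
    by (rule continuous_attains_inf[OF compC])
  then obtain p where p: "p \<in> C" "\<forall>p'\<in>C. m p \<le> m p'" ..
  have "\<exists>z w. (z, w) \<in> C \<and> norm w \<le> norm z \<and> norm z = m p"
  proof (cases p)
    case (Pair a b)
    show ?thesis
    proof (cases "norm b \<le> norm a")
      case True
      then have "norm a = m p" by (simp add: m_def Pair)
      with True p(1) Pair show ?thesis by blast
    next
      case False
      then have "norm a \<le> norm b" "norm b = m p" by (simp_all add: m_def Pair)
      moreover have "(b, a) \<in> C"
      proof (rule C_I)
        have "a \<in> A \<and> b \<in> A \<and> f a = f b \<and> a \<noteq> b" using C_D p(1) Pair by blast
        then show "b \<in> cball 0 R - {0}" "a \<in> cball 0 R - {0}" "f b = f a" "b \<noteq> a"
          using AR by auto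
      qed
      ultimately show ?thesis by blast
    qed
  qed
  then obtain z w where zw: "(z, w) \<in> C" "norm w \<le> norm z" "norm z = m p" by blast
  have zA: "z \<in> A" and wA: "w \<in> A" and fzw: "f z = f w" and "z \<noteq> w"
    using C_D[OF zw(1)] by auto
  then have wz: "norm w < norm z"
    using circ[of z w] zw(2) AD by fastforce
  have wD: "w \<in> ?D" and zD: "z \<in> ?D" using wA zA AD by auto
  \<comment> \<open>The disk of radius \<open>\<eta>\<close> about \<open>w\<close> avoids the pole and stays well inside \<open>\<bar>x\<bar> < \<bar>z\<bar>\<close>.\<close>
  define \<eta> where "\<eta> = min (\<rho> w) (min ((norm z - norm w) / 2) (min (norm w) (1 - norm w)))"
  have \<eta>: "\<eta> > 0" "\<eta> \<le> \<rho> w" "2 * \<eta> \<le> norm z - norm w" "\<eta> \<le> norm w" "\<eta> \<le> 1 - norm w"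
    using \<rho>(1)[OF wD] wz wD by (auto simp: \<eta>_def min_def)
  have U: "x \<in> ?D" "norm x < norm w + \<eta>" if "x \<in> ball w \<eta>" for x
  proof -
    show "norm x < norm w + \<eta>"
      using that norm_triangle_sub[of x w] by (auto simp: dist_norm norm_minus_commute)
    then show "x \<in> ?D" using \<eta> that by auto
  qed
  have "open (f ` ball w \<eta>)"
  proof (rule open_mapping_thm3)
    show "f holomorphic_on ball w \<eta>" using f by (rule holomorphic_on_subset) (use U in blast)
    show "inj_on f (ball w \<eta>)" using \<rho>(2)[OF wD] by (rule inj_on_subset) (use \<eta> in auto)
  qed simp
  moreover have "f z \<in> f ` ball w \<eta>" using fzw \<eta> by auto
  moreover have "((\<lambda>t. f (of_real t * z)) \<longlongrightarrow> f z) (at_left 1)"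
  proof -
    have "isCont f z" using contf zD D by (simp add: continuous_on_eq_continuous_at)
    moreover have "((\<lambda>t. of_real t * z) \<longlongrightarrow> z) (at_left (1::real))"
      by (auto intro!: tendsto_eq_intros)
    ultimately show ?thesis by (rule isCont_tendsto_compose)
  qed
  ultimately have "\<forall>\<^sub>F t in at_left 1. f (of_real t * z) \<in> f ` ball w \<eta>"
    by (rule topological_tendstoD[rotated])
  moreover have "\<forall>\<^sub>F t in at_left (1::real). norm w + \<eta> < t * norm z"
  proof (rule order_tendstoD(1))
    show "((\<lambda>t. t * norm z) \<longlongrightarrow> 1 * norm z) (at_left 1)" by (intro tendsto_intros)
    show "norm w + \<eta> < 1 * norm z" using \<eta> by simp
  qed
  moreover have "\<forall>\<^sub>F t in at_left (1::real). t \<in> {0<..<1}"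
    by (rule eventually_at_left_real) simp
  ultimately have "\<forall>\<^sub>F t in at_left (1::real). f (of_real t * z) \<in> f ` ball w \<eta>
      \<and> norm w + \<eta> < t * norm z \<and> t \<in> {0<..<1}"
    by (intro eventually_conj)
  then obtain t where t: "f (of_real t * z) \<in> f ` ball w \<eta>" "norm w + \<eta> < t * norm z" "0 < t" "t < 1"
    using eventually_happens trivial_limit_at_left_real by fastforce
  then obtain x where x: "x \<in> ball w \<eta>" "f (of_real t * z) = f x" by blast
  have nt: "norm (of_real t * z) = t * norm z" "t * norm z < norm z"
    using t zD by (auto simp: norm_mult)
  have "norm x < t * norm z" using U(2)[OF x(1)] t by simp
  moreover have zR: "norm z \<le> R" using zA by (auto simp: A_def)
  ultimately have "t * norm z \<le> R" "norm x \<le> R" "of_real t * z \<noteq> x"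
    using nt by auto
  then have "(of_real t * z, x) \<in> C"
    using x U(1)[OF x(1)] nt(1) t zD by (intro C_I) auto
  from bspec[OF p(2) this] have "norm z \<le> max (norm (of_real t * z)) (norm x)"
    unfolding zw(3) by (simp add: m_def)
  with nt \<open>norm x < t * norm z\<close> show False by (simp add: max_def split: if_splits)
qed

text \<open>
  The omitted set is the intersection of the complements of \<open>V = f ` (ball 0 r - {0})\<close>, so it is
  enough to find supporting lines of \<open>- V\<close>. Its frontier lies on the image of the circle
  \<open>\<bar>z\<bar> = r\<close>, and the tangent at \<open>f z0\<close> supports it: the open half-plane \<open>H\<close> on the other side meets
  \<open>V\<close> (next to \<open>f z0\<close>) but not the frontier of \<open>V\<close>, so by connectedness \<open>H \<subseteq> V\<close>. Passing to
  \<open>r < 1\<close> also provides the interior point that \<open>convex_if_supported\<close> asks for; the omitted set of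
  \<open>f\<close> itself may be a segment.
\<close>

lemma convex_complement_if_curves_on_one_side:
  fixes f g :: "complex \<Rightarrow> complex"
  assumes f: "f holomorphic_on ball 0 1 - {0}" and g: "g holomorphic_on ball 0 1"
    and fg: "\<And>z. z \<in> ball 0 1 - {0} \<Longrightarrow> f z = 1 / z + g z"
    and nz: "\<And>z. z \<in> ball 0 1 - {0} \<Longrightarrow> deriv f z \<noteq> 0"
    and inj: "inj_on f (ball 0 1 - {0})"
    and side: "\<And>z0 z. z0 \<in> ball 0 1 - {0} \<Longrightarrow> norm z = norm z0 \<Longrightarrow>
                 Re ((f z - f z0) / (z0 * deriv f z0)) \<ge> 0"
  shows "convex (- f ` (ball 0 1 - {0}))"
proof -
  have Re_div: "Re ((y - x) / n) \<ge> 0 \<longleftrightarrow> n \<bullet> x \<le> n \<bullet> y" if "n \<noteq> 0" for x y n :: complex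
  proof -
    have "Re ((y - x) / n) = (n \<bullet> y - n \<bullet> x) / (norm n)\<^sup>2"
      by (simp add: Re_divide inner_complex_def cmod_power2 algebra_simps)
    then show ?thesis using that by (simp add: zero_le_divide_iff)
  qed
  have conv: "convex (- f ` (ball 0 r - {0}))" if r: "0 < r" "r < 1" for r
  proof -
    define V where "V = f ` (ball 0 r - {0})"
    have rD: "ball 0 r - {0} \<subseteq> ball (0::complex) 1 - {0}" using r by auto
    have openV: "open V"
      unfolding V_def using holomorphic_on_subset[OF f rD] inj_on_subset[OF inj rD]
      by (intro open_mapping_thm3) auto
    have cl: "closure V \<subseteq> f ` (cball 0 r - {0})"
    proof
      fix v assume "v \<in> closure V"
      then obtain y where y: "\<And>n. y n \<in> V" "y \<longlonglongrightarrow> v"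
        unfolding closure_sequential by blast
      then have "\<forall>n. \<exists>x. x \<in> ball 0 r - {0} \<and> y n = f x" unfolding V_def by blast
      then obtain x where x: "\<And>n. x n \<in> ball 0 r - {0}" "\<And>n. y n = f (x n)" by metis
      have "\<forall>n. x n \<in> cball 0 r"
      proof
        show "x n \<in> cball 0 r" for n using x(1)[of n] by auto
      qed
      then obtain \<zeta> s where s: "\<zeta> \<in> cball 0 r" "strict_mono s" "(x \<circ> s) \<longlonglongrightarrow> \<zeta>"
        using compact_cball[of "0::complex" r] unfolding compact_def by metis
      have "(\<lambda>n. f ((x \<circ> s) n)) \<longlonglongrightarrow> v"
        using LIMSEQ_subseq_LIMSEQ[OF y(2) s(2)] by (simp add: o_def x(2))
      then have "\<zeta> \<noteq> 0 \<and> f \<zeta> = v"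
        by (intro limit_of_values[OF g fg _ s(3)]) (use x(1) s(1) r in \<open>auto simp: less_trans[OF _ r(2)]\<close>)
      then show "v \<in> f ` (cball 0 r - {0})" using s(1) by auto
    qed
    have fr: "\<exists>z. norm z = r \<and> v = f z" if "v \<in> frontier V" for v
    proof -
      have "v \<in> closure V" "v \<notin> V" using that openV by (auto simp: frontier_def interior_open)
      then obtain z where "z \<in> cball 0 r - {0}" "v = f z" "z \<notin> ball 0 r - {0}"
        using cl unfolding V_def by blast
      then show ?thesis by (intro exI[of _ z]) auto
    qed
    have "convex (- V)"
    proof (rule convex_if_supported)
      show "closed (- V)" using openV by auto
      \<comment> \<open>By injectivity, \<open>- V\<close> contains the image of the outer annulus.\<close>
      define z where "z = complex_of_real ((r + 1) / 2)"
      have z: "norm z = (r + 1) / 2" using r unfolding z_def norm_of_real by simp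
      have "f ` (ball 0 1 - cball 0 r) \<subseteq> - V"
        using inj r unfolding V_def inj_on_def by force
      moreover have "open (f ` (ball 0 1 - cball 0 r))"
        using r by (intro open_mapping_thm3 holomorphic_on_subset[OF f] inj_on_subset[OF inj]) auto
      ultimately have "f ` (ball 0 1 - cball 0 r) \<subseteq> interior (- V)"
        by (rule interior_maximal)
      moreover have "z \<in> ball 0 1 - cball 0 r" using z r by auto
      ultimately show "interior (- V) \<noteq> {}" by blast
      fix x assume "x \<in> frontier (- V)"
      then obtain z0 where z0: "norm z0 = r" "x = f z0"
        using fr by (auto simp: frontier_complement)
      then have z0D: "z0 \<in> ball 0 1 - {0}" using r by auto
      define n where "n = z0 * deriv f z0"
      have n: "n \<noteq> 0" using z0D nz[OF z0D] by (auto simp: n_def)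
      define H where "H = {y. n \<bullet> y < n \<bullet> x}"
      \<comment> \<open>Moving from \<open>z0\<close> towards the origin, \<open>f\<close> enters \<open>H\<close>.\<close>
      have "((\<lambda>t. of_real t * z0) has_vector_derivative z0) (at (1::real))"
        by (auto intro!: derivative_eq_intros)
      from field_vector_diff_chain_at[OF this, of f "deriv f z0"]
      have "((\<lambda>t. f (of_real t * z0)) has_vector_derivative n) (at 1)"
        using holomorphic_derivI[OF f _ z0D] by (simp add: o_def n_def open_delete)
      then have "((\<lambda>t. n \<bullet> f (of_real t * z0)) has_real_derivative n \<bullet> n) (at 1)"
        unfolding has_real_derivative_iff_has_vector_derivative
        by (rule bounded_linear.has_vector_derivative[OF bounded_linear_inner_right])
      then obtain d where d: "d > 0" "\<And>h. 0 < h \<Longrightarrow> h < d \<Longrightarrow>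
          n \<bullet> f (of_real (1 - h) * z0) < n \<bullet> f (of_real 1 * z0)"
        using DERIV_pos_inc_left[of "\<lambda>t. n \<bullet> f (of_real t * z0)" "n \<bullet> n" 1] n by auto
      define h where "h = min d 1 / 2"
      have h: "0 < h" "h < d" "h < 1" using d(1) by (auto simp: h_def)
      have "norm (of_real (1 - h) * z0) < r"
        using h z0 r unfolding norm_mult norm_of_real by simp
      then have "f (of_real (1 - h) * z0) \<in> H \<inter> V"
        unfolding H_def V_def using d(2)[OF h(1,2)] z0 z0D h 
        by (auto simp: of_real_diff[symmetric] simp del: of_real_diff)
      moreover have "connected H"
        unfolding H_def by (intro convex_connected convex_halfspace_lt)
      moreover have "H \<inter> frontier V = {}"
        using fr side[OF z0D] z0 n unfolding H_def n_def[symmetric]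
        by (force simp: Re_div)
      ultimately have "H \<subseteq> V"
        using connected_Int_frontier[of H V] by blast
      then show "\<exists>a. a \<noteq> 0 \<and> (\<forall>y\<in>- V. a \<bullet> x \<le> a \<bullet> y)"
        using n unfolding H_def by (intro exI[of _ n]) (auto simp: not_less[symmetric])
    qed
    then show ?thesis by (simp add: V_def)
  qed
  have "- f ` (ball 0 1 - {0}) = (\<Inter>r\<in>{0<..<1}. - f ` (ball 0 r - {0}))"
  proof -
    have "ball 0 1 - {0} = (\<Union>r\<in>{0<..<1}. ball (0::complex) r - {0})"
    proof (intro set_eqI iffI)
      fix z :: complex assume z: "z \<in> ball 0 1 - {0}"
      then show "z \<in> (\<Union>r\<in>{0<..<1}. ball (0::complex) r - {0})"
        by (intro UN_I[of "(norm z + 1) / 2"]) (auto intro: add_nonneg_pos)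
    qed auto
    then show ?thesis by (simp only: image_UN Compl_UN)
  qed
  then show ?thesis
    using conv by (auto intro!: convex_INT)
qed

section \<open>From concavity to tangent lines\<close>

text \<open>
  The maximum principle with a boundary condition: compactness of the superlevel sets says that
  the upper limit of \<open>\<bar>k\<bar>\<close> at the boundary of \<open>U\<close> is at most \<open>c\<close>, without any continuity of \<open>k\<close>
  there. On the frontier of such a set \<open>\<bar>k\<bar> \<le> c'\<close>, so \<open>\<bar>k\<bar>\<close> cannot exceed \<open>c'\<close> inside.
\<close>

lemma norm_le_if_superlevel_compact:
  fixes k :: "complex \<Rightarrow> complex"
  assumes U: "open U" and hol: "k holomorphic_on U"
    and comp: "\<And>c'. c' > c \<Longrightarrow> compact {s \<in> U. norm (k s) \<ge> c'}"
    and s: "s \<in> U"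
  shows "norm (k s) \<le> c"
proof (rule ccontr)
  assume neg: "\<not> ?thesis"
  define c' where "c' = (c + norm (k s)) / 2"
  have c': "c < c'" "c' < norm (k s)" using neg by (auto simp: c'_def)
  define S where "S = {s \<in> U. norm (k s) \<ge> c'}"
  have S: "compact S" unfolding S_def by (rule comp[OF c'(1)])
  have contk: "continuous_on U k" using hol by (rule holomorphic_on_imp_continuous_on)
  have SU: "S \<subseteq> U" by (auto simp: S_def)
  have "norm (k s) \<le> c'"
  proof (rule maximum_modulus_frontier[of k S])
    show "k holomorphic_on interior S"
      using hol by (rule holomorphic_on_subset) (use SU interior_subset in blast)
    show "continuous_on (closure S) k"
      using contk by (rule continuous_on_subset) (use SU compact_imp_closed[OF S] in simp)
    show "bounded S" using S by (rule compact_imp_bounded)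
    show "s \<in> S" using s c' by (auto simp: S_def)
    fix z assume z: "z \<in> frontier S"
    show "norm (k z) \<le> c'"
    proof (rule ccontr)
      assume "\<not> ?thesis"
      moreover have "z \<in> S" using z frontier_subset_compact[OF S] by blast
      moreover have "open {s \<in> U. c' < norm (k s)}"
      proof -
        have "open (U \<inter> (\<lambda>s. norm (k s)) -` {c'<..})"
          using contk U by (intro continuous_open_preimage continuous_intros) auto
        also have "U \<inter> (\<lambda>s. norm (k s)) -` {c'<..} = {s \<in> U. c' < norm (k s)}" by auto
        finally show ?thesis .
      qed
      ultimately have "z \<in> interior S"
        using SU by (intro interiorI[of "{s \<in> U. c' < norm (k s)}"]) (auto simp: S_def)
      then show False using z by (simp add: frontier_def)
    qed
  qed
  then show False using c' by simp
qed

lemma bounded_away_from_pole: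
  fixes f g :: "complex \<Rightarrow> complex"
  assumes g: "g holomorphic_on ball 0 1"
    and fg: "\<And>z. z \<in> ball 0 1 - {0} \<Longrightarrow> f z = 1 / z + g z"
    and inj: "inj_on f (ball 0 1 - {0})"
    and r: "0 < r" "r \<le> 1"
  obtains M where "\<And>z. r \<le> norm z \<Longrightarrow> norm z < 1 \<Longrightarrow> norm (f z) \<le> M"
proof -
  obtain M where M: "\<And>w. norm w > M \<Longrightarrow> w \<in> f ` (ball 0 r - {0})"
    using eventually_covers_neighbourhood_of_infinity[OF g fg r] by metis
  show thesis
  proof (rule that, rule ccontr)
    fix z assume z: "r \<le> norm z" "norm z < 1" "\<not> norm (f z) \<le> M"
    then have "f z \<in> f ` (ball 0 r - {0})" by (intro M) simp
    then obtain w where w: "w \<in> ball 0 r - {0}" "f z = f w" by blast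
    have "z = w" by (rule inj_onD[OF inj w(2)]) (use z w r in auto)
    then show False using w z by auto
  qed
qed

lemma boundary_limit_is_omitted:
  fixes f :: "complex \<Rightarrow> complex"
  assumes f: "f holomorphic_on ball 0 1 - {0}" and inj: "inj_on f (ball 0 1 - {0})"
    and x: "\<And>n. x n \<in> ball 0 1 - {0}" "x \<longlonglongrightarrow> \<zeta>" and \<zeta>: "norm \<zeta> = 1"
    and A: "(\<lambda>n. f (x n)) \<longlonglongrightarrow> A"
  shows "A \<in> - f ` (ball 0 1 - {0})"
proof
  let ?D = "ball (0::complex) 1 - {0}"
  assume "A \<in> f ` ?D"
  then obtain z where z: "z \<in> ?D" "A = f z" by blast
  have D: "open ?D" by auto
  obtain F where F: "F holomorphic_on f ` ?D" "\<And>z. z \<in> ?D \<Longrightarrow> F (f z) = z"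
    using holomorphic_has_inverse[OF f D inj] by metis
  have "(\<lambda>n. F (f (x n))) \<longlonglongrightarrow> F A"
    using holomorphic_on_imp_continuous_on[OF F(1)] A \<open>A \<in> f ` ?D\<close>
    by (rule continuous_on_tendsto_compose) (use x(1) in auto)
  then have "x \<longlonglongrightarrow> z"
    using F(2) x(1) z by simp
  then have "z = \<zeta>" using x(2) LIMSEQ_unique by blast
  then show False using z \<zeta> by auto
qed

text \<open>
  Let \<open>m x = (1 - t) f(a x) + t f(b x)\<close> and let \<open>F\<close> be the inverse of \<open>f\<close>. The claim is that
  \<open>k x = x / F (m x)\<close>, defined where \<open>m x\<close> is a value of \<open>f\<close>, is bounded by \<open>1\<close>. This is a maximum
  principle, so only the boundary matters. At a boundary point with \<open>\<bar>x\<bar> < 1\<close>, \<open>m x\<close> approaches the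
  omitted set and \<open>\<bar>F (m x)\<bar>\<close> tends to \<open>1\<close>; at \<open>\<bar>x\<bar> = 1\<close> both \<open>f(a x)\<close> and \<open>f(b x)\<close> approach the
  omitted set and by its convexity so does \<open>m x\<close>; at the puncture \<open>k x\<close> tends to
  \<open>(1 - t) / a + t / b\<close>, a point of the closed disk.

  In the proof these cases are the possible limits \<open>\<xi>\<close> of a sequence of points \<open>x n\<close> with
  \<open>\<bar>k (x n)\<bar> \<ge> c > 1\<close>, where \<open>y n = F (m (x n))\<close> stays away from the unit circle.
\<close>

lemma modulus_le_modulus_preimage_convex_combination:
  fixes f g :: "complex \<Rightarrow> complex" and a b :: complex and t :: real
  assumes f: "f holomorphic_on ball 0 1 - {0}" and g: "g holomorphic_on ball 0 1"
    and fg: "\<And>z. z \<in> ball 0 1 - {0} \<Longrightarrow> f z = 1 / z + g z"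
    and inj: "inj_on f (ball 0 1 - {0})"
    and conv: "convex (- f ` (ball 0 1 - {0}))"
    and ab: "norm a = 1" "norm b = 1" and t: "0 \<le> t" "t \<le> 1"
    and s: "s \<in> ball 0 1 - {0}" and h: "h \<in> ball 0 1 - {0}"
    and eq: "f h = (1 - t) *\<^sub>R f (a * s) + t *\<^sub>R f (b * s)"
  shows "norm s \<le> norm h"
proof -
  let ?D = "ball (0::complex) 1 - {0}"
  have D: "open ?D" by auto
  have contf: "continuous_on ?D f" using f by (rule holomorphic_on_imp_continuous_on)
  obtain F where F: "F holomorphic_on f ` ?D" "\<And>z. z \<in> ?D \<Longrightarrow> F (f z) = z"
    using holomorphic_has_inverse[OF f D inj] by metis
  have \<Omega>: "open (f ` ?D)" using f D inj by (rule open_mapping_thm3)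
  have rot: "a * x \<in> ?D" "b * x \<in> ?D" if "x \<in> ?D" for x
    using that ab by (auto simp: norm_mult)
  define m where "m x = (1 - t) *\<^sub>R f (a * x) + t *\<^sub>R f (b * x)" for x
  have "(\<lambda>x. f (a * x)) holomorphic_on ?D" "(\<lambda>x. f (b * x)) holomorphic_on ?D"
    using rot by (auto intro!: holomorphic_on_compose_gen[OF _ f, unfolded o_def] holomorphic_intros)
  then have holm: "m holomorphic_on ?D"
    unfolding m_def scaleR_conv_of_real by (intro holomorphic_intros)
  define U where "U = {x \<in> ?D. m x \<in> f ` ?D}"
  have UD: "U \<subseteq> ?D" by (auto simp: U_def)
  have "open (?D \<inter> m -` (f ` ?D))"
    using holomorphic_on_imp_continuous_on[OF holm] D \<Omega> by (rule continuous_open_preimage)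
  also have "?D \<inter> m -` (f ` ?D) = U" by (auto simp: U_def)
  finally have "open U" .
  define k where "k x = x / F (m x)" for x
  have Fm: "F (m x) \<in> ?D" "f (F (m x)) = m x" if xU: "x \<in> U" for x
  proof -
    obtain z where "z \<in> ?D" "m x = f z" using xU unfolding U_def by blast
    then show "F (m x) \<in> ?D" "f (F (m x)) = m x" using F(2)[of z] by simp_all
  qed
  have "(\<lambda>x. F (m x)) holomorphic_on U"
    by (rule holomorphic_on_compose_gen[OF holomorphic_on_subset[OF holm UD] F(1), unfolded o_def])
       (auto simp: U_def)
  then have holk: "k holomorphic_on U"
    unfolding k_def using Fm by (intro holomorphic_intros) auto
  have comp: "compact {x \<in> U. norm (k x) \<ge> c}" if c: "c > 1" for c
    unfolding compact_def
  proof (intro allI impI)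
    fix \<sigma> :: "nat \<Rightarrow> complex" assume \<sigma>: "\<forall>n. \<sigma> n \<in> {x \<in> U. norm (k x) \<ge> c}"
    have in_cball: "\<forall>n. (\<sigma> n, F (m (\<sigma> n))) \<in> cball 0 1 \<times> cball 0 1"
    proof
      fix n show "(\<sigma> n, F (m (\<sigma> n))) \<in> cball 0 1 \<times> cball 0 1"
      proof -
        have "\<sigma> n \<in> U" using \<sigma> by blast
        then have "\<sigma> n \<in> ?D" "F (m (\<sigma> n)) \<in> ?D" using UD Fm(1) by blast+
        then show ?thesis by auto
      qed
    qed
    have "compact (cball (0::complex) 1 \<times> cball (0::complex) 1)"
      by (intro compact_Times compact_cball)
    from seq_compactE[OF compact_imp_seq_compact[OF this] in_cball]
    obtain l r where lr: "l \<in> cball 0 1 \<times> cball 0 1" "strict_mono (r :: nat \<Rightarrow> nat)"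
        "((\<lambda>n. (\<sigma> n, F (m (\<sigma> n)))) \<circ> r) \<longlonglongrightarrow> l" .
    define x where "x = \<sigma> \<circ> r"
    define y where "y n = F (m (x n))" for n
    obtain \<xi> \<eta> where l: "l = (\<xi>, \<eta>)" by (cases l)
    have lim: "x \<longlonglongrightarrow> \<xi>" "y \<longlonglongrightarrow> \<eta>"
      using tendsto_fst[OF lr(3)] tendsto_snd[OF lr(3)] by (auto simp: o_def x_def y_def[abs_def] l)
    have xU: "x n \<in> U" and kx: "norm (k (x n)) \<ge> c" for n using \<sigma> by (auto simp: x_def)
    have xD: "x n \<in> ?D" for n using xU UD by blast
    have yD: "y n \<in> ?D" and fy: "f (y n) = m (x n)" for n using Fm xU by (auto simp: y_def)
    have yx: "c * norm (y n) \<le> norm (x n)" for n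
      using kx[of n] yD[of n] by (simp add: k_def y_def norm_divide field_simps)
    have "c * norm \<eta> \<le> norm \<xi>"
      by (rule LIMSEQ_le[of "\<lambda>n. c * norm (y n)" _ "\<lambda>n. norm (x n)"])
         (use yx in \<open>auto intro!: tendsto_intros lim\<close>)
    moreover have \<xi>: "norm \<xi> \<le> 1" using lr(1) l by simp
    ultimately have \<eta>le: "c * norm \<eta> \<le> norm \<xi>" and \<eta>D: "\<eta> \<in> ball 0 1"
    proof -
      have "norm \<eta> < 1"
      proof (rule ccontr)
        assume "\<not> ?thesis"
        then have "c * 1 \<le> c * norm \<eta>" using c by (intro mult_left_mono) auto
        then show False using \<open>c * norm \<eta> \<le> norm \<xi>\<close> \<xi> c by linarith
      qed
      then show "\<eta> \<in> ball 0 1" by simp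
    qed
    have "\<xi> \<in> {x \<in> U. norm (k x) \<ge> c}"
    proof -
      consider "\<xi> = 0" | "\<xi> \<in> ?D" | "norm \<xi> = 1" using \<xi> by fastforce
      then show ?thesis
      proof cases
        case 1
        have "\<eta> = 0" using \<eta>le c 1 by (simp add: mult_le_0_iff)
        \<comment> \<open>Residue \<open>1\<close> at the pole: it turns \<open>c \<bar>y n\<bar> \<le> \<bar>x n\<bar>\<close> into an estimate between convergent sequences.\<close>
        have res: "(\<lambda>n. v n * f (v n)) \<longlonglongrightarrow> 1" if v: "\<And>n. v n \<in> ?D" "v \<longlonglongrightarrow> 0" for v
        proof -
          have "(\<lambda>n. g (v n)) \<longlonglongrightarrow> g 0"
            by (rule continuous_on_tendsto_compose[OF holomorphic_on_imp_continuous_on[OF g] v(2)])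
               (use v(1) in auto)
          then have "(\<lambda>n. 1 + v n * g (v n)) \<longlonglongrightarrow> 1 + 0 * g 0"
            by (intro tendsto_intros v)
          moreover have "v n * f (v n) = 1 + v n * g (v n)" for n
            using v(1)[of n] fg[OF v(1)[of n]] by (simp add: distrib_left)
          ultimately show ?thesis by simp
        qed
        have xa: "(\<lambda>n. a * x n * f (a * x n)) \<longlonglongrightarrow> 1" "(\<lambda>n. b * x n * f (b * x n)) \<longlonglongrightarrow> 1"
          by (rule res[OF rot(1)[OF xD]] res[OF rot(2)[OF xD]],
              use tendsto_mult_right_zero[of x] lim(1) 1 in blast)+
        have "(\<lambda>n. (1 - t) *\<^sub>R (a * x n * f (a * x n) / a) + t *\<^sub>R (b * x n * f (b * x n) / b))
            \<longlonglongrightarrow> (1 - t) *\<^sub>R (1 / a) + t *\<^sub>R (1 / b)"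
          using ab by (intro tendsto_intros xa) auto
        moreover have "(1 - t) *\<^sub>R (a * x n * f (a * x n) / a) + t *\<^sub>R (b * x n * f (b * x n) / b)
            = x n * m (x n)" for n
        proof -
          have "a * x n * f (a * x n) / a = x n * f (a * x n)"
               "b * x n * f (b * x n) / b = x n * f (b * x n)" using ab by auto
          then show ?thesis by (simp add: m_def distrib_left)
        qed
        ultimately have xm: "(\<lambda>n. x n * m (x n)) \<longlonglongrightarrow> (1 - t) *\<^sub>R (1 / a) + t *\<^sub>R (1 / b)"
          by simp
        have ym: "(\<lambda>n. y n * m (x n)) \<longlonglongrightarrow> 1"
          using res[OF yD] lim(2) \<open>\<eta> = 0\<close> by (simp add: fy)
        have "c * norm (y n * m (x n)) \<le> norm (x n * m (x n))" for n
          using mult_right_mono[OF yx[of n], of "norm (m (x n))"] by (simp add: norm_mult mult.assoc)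
        then have "c * norm (1::complex) \<le> norm ((1 - t) *\<^sub>R (1 / a) + t *\<^sub>R (1 / b))"
          by (intro LIMSEQ_le[OF tendsto_mult[OF tendsto_const tendsto_norm[OF ym]] tendsto_norm[OF xm]]) blast
        also have "\<dots> \<le> (1 - t) * 1 + t * 1"
          using norm_triangle_ineq[of "(1 - t) *\<^sub>R (1 / a)" "t *\<^sub>R (1 / b)"] ab t
          by (simp add: norm_divide)
        finally show ?thesis using c by simp
      next
        case 2
        have "(\<lambda>n. m (x n)) \<longlonglongrightarrow> m \<xi>"
          by (rule continuous_on_tendsto_compose[OF holomorphic_on_imp_continuous_on[OF holm] lim(1) 2])
             (use xD in auto)
        then have "(\<lambda>n. f (y n)) \<longlonglongrightarrow> m \<xi>" by (simp add: fy)
        then have *: "\<eta> \<noteq> 0 \<and> f \<eta> = m \<xi>"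
          using limit_of_values[OF g fg yD lim(2) \<eta>D] by blast
        then have \<eta>: "\<eta> \<in> ?D" using \<eta>D by auto
        then have "\<xi> \<in> U" using 2 * unfolding U_def by (metis (mono_tags, lifting) imageI mem_Collect_eq)
        moreover have "F (m \<xi>) = \<eta>" using F(2)[OF \<eta>] * by simp
        ultimately show ?thesis
          using \<eta>le \<eta> by (simp add: k_def norm_divide field_simps)
      next
        case 3
        \<comment> \<open>Close to the unit circle \<open>f\<close> is bounded, so \<open>f (a x)\<close> and \<open>f (b x)\<close> have limits along a subsequence \<open>j\<close>.\<close>
        have half: "0 < (1/2::real)" "(1/2::real) \<le> 1" by auto
        obtain M where M: "\<And>z. 1/2 \<le> norm z \<Longrightarrow> norm z < 1 \<Longrightarrow> norm (f z) \<le> M"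
          using bounded_away_from_pole[OF g fg inj half] by metis
        have "\<forall>\<^sub>F n in sequentially. norm (x n) > 1/2"
          using tendsto_norm[OF lim(1)] 3 by (intro order_tendstoD(1)) auto
        then obtain N where N: "\<And>n. n \<ge> N \<Longrightarrow> norm (x n) > 1/2"
          unfolding eventually_sequentially by auto
        have in_cball: "\<forall>n. (f (a * x (n + N)), f (b * x (n + N))) \<in> cball 0 M \<times> cball 0 M"
        proof
          fix n 
          show "(f (a * x (n + N)), f (b * x (n + N))) \<in> cball 0 M \<times> cball 0 M"
            using N[of "n + N"] xD[of "n + N"] ab by (auto intro!: M simp: norm_mult)
        qed
        have "compact (cball (0::complex) M \<times> cball (0::complex) M)"
          by (intro compact_Times compact_cball)
        from seq_compactE[OF compact_imp_seq_compact[OF this] in_cball]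
        obtain l' r' where lr': "strict_mono (r' :: nat \<Rightarrow> nat)"
            "((\<lambda>n. (f (a * x (n + N)), f (b * x (n + N)))) \<circ> r') \<longlonglongrightarrow> l'" .
        define j where "j n = r' n + N" for n
        have j: "strict_mono j" using lr'(1) by (auto simp: j_def strict_mono_def)
        have xj: "(\<lambda>n. x (j n)) \<longlonglongrightarrow> \<xi>" and yj: "(\<lambda>n. y (j n)) \<longlonglongrightarrow> \<eta>"
          using LIMSEQ_subseq_LIMSEQ[OF _ j] lim by (auto simp: o_def)
        have A: "(\<lambda>n. f (a * x (j n))) \<longlonglongrightarrow> fst l'" and B: "(\<lambda>n. f (b * x (j n))) \<longlonglongrightarrow> snd l'"
          using tendsto_fst[OF lr'(2)] tendsto_snd[OF lr'(2)] by (auto simp: o_def j_def)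
        have "fst l' \<in> - f ` ?D"
          by (rule boundary_limit_is_omitted[OF f inj _ _ _ A, of "a * \<xi>"])
             (use rot(1)[OF xD] 3 ab in \<open>auto intro!: tendsto_intros xj simp: norm_mult\<close>)
        moreover have "snd l' \<in> - f ` ?D"
          by (rule boundary_limit_is_omitted[OF f inj _ _ _ B, of "b * \<xi>"])
             (use rot(2)[OF xD] 3 ab in \<open>auto intro!: tendsto_intros xj simp: norm_mult\<close>)
        ultimately have "(1 - t) *\<^sub>R fst l' + t *\<^sub>R snd l' \<in> - f ` ?D"
          using conv t by (auto simp: convex_alt)
        moreover have "(\<lambda>n. m (x (j n))) \<longlonglongrightarrow> (1 - t) *\<^sub>R fst l' + t *\<^sub>R snd l'"
          unfolding m_def by (intro tendsto_intros A B)
        then have "\<eta> \<noteq> 0 \<and> f \<eta> = (1 - t) *\<^sub>R fst l' + t *\<^sub>R snd l'"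
          using limit_of_values[OF g fg yD yj \<eta>D] by (simp add: fy)
        ultimately show ?thesis
          using \<eta>D by (metis ComplD DiffI imageI singletonD)
      qed
    qed
    then show "\<exists>l\<in>{x \<in> U. c \<le> norm (k x)}. \<exists>r. strict_mono r \<and> (\<sigma> \<circ> r) \<longlonglongrightarrow> l"
      using lr(2) lim(1) unfolding x_def by blast
  qed
  have ms: "m s = f h" using eq by (simp add: m_def)
  then have "s \<in> U" using s h unfolding U_def by auto
  have "norm (k s) \<le> 1"
    by (rule norm_le_if_superlevel_compact[OF \<open>open U\<close> holk comp \<open>s \<in> U\<close>])
  moreover have "k s = s / h" using F(2)[OF h] by (simp add: k_def ms)
  ultimately show ?thesis using h by (simp add: norm_divide divide_le_eq_1)
qed

text \<open>
  Apply the previous lemma with \<open>a s = z0\<close> and \<open>b s = z\<close>: the preimage of the point \<open>w t\<close> on the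
  segment from \<open>f z0\<close> to \<open>f z\<close> has modulus at least \<open>\<bar>z0\<bar>\<close>. Its squared modulus \<open>\<delta> t\<close> therefore
  cannot decrease at \<open>t = 0\<close>, and \<open>\<delta>' 0\<close> is \<open>2 \<bar>z0\<bar>\<^sup>2\<close> times the quantity in question.
\<close>

lemma curve_on_one_side_of_tangent_if_convex_complement:
  fixes f g :: "complex \<Rightarrow> complex"
  assumes f: "f holomorphic_on ball 0 1 - {0}" and g: "g holomorphic_on ball 0 1"
    and fg: "\<And>z. z \<in> ball 0 1 - {0} \<Longrightarrow> f z = 1 / z + g z"
    and inj: "inj_on f (ball 0 1 - {0})"
    and conv: "convex (- f ` (ball 0 1 - {0}))"
    and z0: "z0 \<in> ball 0 1 - {0}" and z: "norm z = norm z0"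
  shows "Re ((f z - f z0) / (z0 * deriv f z0)) \<ge> 0"
proof (rule ccontr)
  let ?D = "ball (0::complex) 1 - {0}"
  assume neg: "\<not> ?thesis"
  have D: "open ?D" by auto
  obtain F where F: "F holomorphic_on f ` ?D" "\<And>z. z \<in> ?D \<Longrightarrow> deriv f z * deriv F (f z) = 1"
      "\<And>z. z \<in> ?D \<Longrightarrow> F (f z) = z"
    using holomorphic_has_inverse[OF f D inj] by metis
  have \<Omega>: "open (f ` ?D)" using f D inj by (rule open_mapping_thm3)
  define v where "v = f z - f z0"
  define w where "w t = f z0 + t *\<^sub>R v" for t :: real
  define \<delta> where "\<delta> t = F (w t) \<bullet> F (w t)" for t
  have w0: "w 0 = f z0" by (simp add: w_def)
  have "(w has_vector_derivative v) (at 0)"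
    unfolding w_def by (auto intro!: derivative_eq_intros)
  moreover have "(F has_field_derivative deriv F (f z0)) (at (w 0))"
    unfolding w0 by (rule holomorphic_derivI[OF F(1) \<Omega>]) (use z0 in auto)
  ultimately have "(F \<circ> w has_vector_derivative v * deriv F (f z0)) (at 0)"
    by (rule field_vector_diff_chain_at)
  then have "((\<lambda>t. F (w t)) has_vector_derivative v / deriv f z0) (at 0)"
    using inverse_unique[OF F(2)[OF z0]] by (simp add: o_def divide_inverse)
  then have "(\<delta> has_real_derivative 2 * (z0 \<bullet> (v / deriv f z0))) (at 0)"
    unfolding \<delta>_def[abs_def] has_real_derivative_iff_has_vector_derivative has_vector_derivative_def
    by (auto intro!: derivative_eq_intros simp: w0 F(3)[OF z0] inner_commute algebra_simps)
  moreover have "z0 \<bullet> (v / deriv f z0) < 0"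
  proof -
    define u where "u = v / (z0 * deriv f z0)"
    have "Re u < 0" using neg by (simp add: u_def v_def)
    moreover have "v / deriv f z0 = z0 * u" using z0 by (simp add: u_def)
    moreover have "z0 \<bullet> (z0 * u) = (norm z0)\<^sup>2 * Re u"
      unfolding cmod_power2 by (simp add: inner_complex_def algebra_simps power2_eq_square)
    ultimately show ?thesis using z0 by (simp add: mult_pos_neg)
  qed
  ultimately have "\<exists>d>0. \<forall>h>0. h < d \<longrightarrow> \<delta> h < \<delta> 0"
    using DERIV_neg_dec_right[of \<delta> "2 * (z0 \<bullet> (v / deriv f z0))" 0] by simp
  then obtain d where d: "d > 0" "\<And>h. 0 < h \<Longrightarrow> h < d \<Longrightarrow> \<delta> h < \<delta> 0"
    by blast
  have "(w \<longlongrightarrow> w 0) (at_right 0)"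
    unfolding w_def by (auto intro!: tendsto_eq_intros)
  then have "\<forall>\<^sub>F t in at_right 0. w t \<in> f ` ?D"
    using \<Omega> by (rule topological_tendstoD) (use z0 w0 in auto)
  moreover have "\<forall>\<^sub>F t in at_right (0::real). t \<in> {0<..<min d 1}"
    by (rule eventually_at_right_real) (use d in auto)
  ultimately have "\<forall>\<^sub>F t in at_right 0. w t \<in> f ` ?D \<and> t \<in> {0<..<min d 1}"
    by (rule eventually_conj)
  then have "\<exists>t. w t \<in> f ` ?D \<and> t \<in> {0<..<min d 1}"
    by (rule eventually_happens'[rotated]) simp
  then obtain t where wt: "w t \<in> f ` ?D" and "t \<in> {0<..<min d 1}" by blast
  then have t: "0 < t" "t < d" "t < 1" by auto
  from wt obtain h where h: "h \<in> ?D" "w t = f h" by blast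
  define s where "s = complex_of_real (norm z0)"
  have s: "s \<noteq> 0" "norm s = norm z0" using z0 by (auto simp: s_def)
  have "norm s \<le> norm h"
  proof (rule modulus_le_modulus_preimage_convex_combination[OF f g fg inj conv, of "z0 / s" "z / s" t])
    show "f h = (1 - t) *\<^sub>R f (z0 / s * s) + t *\<^sub>R f (z / s * s)"
      using s h(2) by (simp add: w_def v_def algebra_simps)
  qed (use s z z0 t h in \<open>auto simp: norm_divide\<close>)
  then have "\<delta> 0 \<le> \<delta> t"
    using h F(3) z0 s by (simp add: \<delta>_def w0 dot_square_norm power_mono)
  then show False using d(2)[OF t(1,2)] by simp
qed

section \<open>Bounded functions on the disk\<close>

text \<open>
  On the circle of radius \<open>r\<close> the hypothesis gives \<open>\<bar>\<phi>\<bar> \<le> 1 / r\<^sup>n\<close>; let \<open>r\<close> tend to \<open>1\<close> in the maximum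
  principle.
\<close>

lemma norm_le_1_of_power_mult:
  fixes \<phi> :: "complex \<Rightarrow> complex"
  assumes hol: "\<phi> holomorphic_on ball 0 1"
    and le: "\<And>z. z \<in> ball 0 1 \<Longrightarrow> norm (z ^ n * \<phi> z) \<le> 1"
    and z: "z \<in> ball 0 1"
  shows "norm (\<phi> z) \<le> 1"
proof -
  have *: "norm (\<phi> z) * r ^ n \<le> 1" if r: "norm z < r" "r < 1" for r
  proof -
    have "r > 0" using r(1) norm_ge_zero[of z] by linarith
    have "norm (\<phi> z) \<le> 1 / r ^ n"
    proof (rule maximum_modulus_frontier[of \<phi> "cball 0 r"])
      show "\<phi> holomorphic_on interior (cball 0 r)"
        using hol by (rule holomorphic_on_subset) (use r in auto)
      show "continuous_on (closure (cball 0 r)) \<phi>"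
        using holomorphic_on_imp_continuous_on[OF hol] by (rule continuous_on_subset) (use r in auto)
      fix w :: complex assume "w \<in> frontier (cball 0 r)"
      then have w: "norm w = r" using r by auto
      then have "r ^ n * norm (\<phi> w) \<le> 1"
        using le[of w] r by (auto simp: norm_mult norm_power)
      then show "norm (\<phi> w) \<le> 1 / r ^ n"
        using \<open>r > 0\<close> by (simp add: field_simps)
    qed (use r in auto)
    then show ?thesis
      using \<open>r > 0\<close> by (simp add: field_simps)
  qed
  have "((\<lambda>r. norm (\<phi> z) * r ^ n) \<longlongrightarrow> norm (\<phi> z) * 1 ^ n) (at_left 1)"
    by (intro tendsto_intros)
  moreover have "\<forall>\<^sub>F r in at_left 1. norm (\<phi> z) * r ^ n \<le> 1"
    using eventually_at_left_real[of "norm z" 1] z by (auto elim!: eventually_mono intro: *)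
  ultimately have "norm (\<phi> z) * 1 ^ n \<le> 1"
    by (rule tendsto_upperbound) simp
  then show ?thesis by simp
qed

text \<open>
  The Schwarz lemma for \<open>\<phi>\<close> composed with the disk automorphisms that move \<open>z\<close> and \<open>\<phi> z\<close> to the
  origin. If \<open>\<bar>\<phi>\<bar>\<close> attains the value \<open>1\<close>, these are not available, but then \<open>\<phi>\<close> is constant.
\<close>

lemma Schwarz_Pick:
  fixes \<phi> :: "complex \<Rightarrow> complex"
  assumes hol: "\<phi> holomorphic_on ball 0 1"
    and le: "\<And>z. z \<in> ball 0 1 \<Longrightarrow> norm (\<phi> z) \<le> 1"
    and z: "z \<in> ball 0 1"
  shows "norm (deriv \<phi> z) * (1 - (norm z)\<^sup>2) \<le> 1 - (norm (\<phi> z))\<^sup>2"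
proof (cases "\<exists>w\<in>ball 0 1. norm (\<phi> w) = 1")
  case True
  then obtain w where w: "w \<in> ball 0 1" "norm (\<phi> w) = 1" by blast
  have "\<phi> constant_on ball 0 1"
    by (rule maximum_modulus_principle[OF hol, of "ball 0 1" w]) (use w le in auto)
  then obtain c where c: "\<And>x. x \<in> ball 0 1 \<Longrightarrow> \<phi> x = c" by (auto simp: constant_on_def)
  have "(\<phi> has_field_derivative 0) (at z)"
    by (rule has_field_derivative_transform_within_open[of "\<lambda>_. c" _ _ "ball 0 1"]) (use z c in auto)
  then have "deriv \<phi> z = 0" by (rule DERIV_imp_deriv)
  then show ?thesis using le[OF z] by (simp add: power_le_one)
next
  case False
  then have lt: "norm (\<phi> w) < 1" if "w \<in> ball 0 1" for w
    using le[OF that] that by fastforce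
  define a where "a = \<phi> z"
  have a: "norm a < 1" using lt[OF z] by (simp add: a_def)
  define M where "M = Moebius_function 0"
  have M: "M c holomorphic_on ball 0 1" "\<And>w. norm w < 1 \<Longrightarrow> norm (M c w) < 1" if "norm c < 1" for c
    using that Moebius_function_holomorphic Moebius_function_norm_lt_1 by (auto simp: M_def)
  have nz: "norm (- z) < 1" using z by simp
  define F where "F = (\<lambda>w. M a (\<phi> (M (-z) w)))"
  have maps: "M (-z) ` ball 0 1 \<subseteq> ball 0 1"
    using M(2)[OF nz] by auto
  then have maps': "(\<lambda>w. \<phi> (M (-z) w)) ` ball 0 1 \<subseteq> ball 0 1"
    using lt by (auto simp: image_subset_iff)
  have hol1: "(\<lambda>w. \<phi> (M (-z) w)) holomorphic_on ball 0 1"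
    using holomorphic_on_compose_gen[OF M(1)[OF nz] hol] maps by (simp add: o_def)
  have holF: "F holomorphic_on ball 0 1"
    using holomorphic_on_compose_gen[OF hol1 M(1)[OF a] maps'] by (simp add: o_def F_def)
  have M0: "M (-z) 0 = z" and Ma: "M a a = 0"
    by (simp_all add: M_def Moebius_function_def)
  have one: "1 - cnj c * c = of_real (1 - (norm c)\<^sup>2)" for c
    unfolding of_real_diff complex_norm_square by (simp add: mult.commute)
  have ne: "1 - cnj c * c \<noteq> 0" if "norm c < 1" for c
  proof -
    have "1 - (norm c)\<^sup>2 > 0" using that by (simp add: abs_square_less_1)
    then show ?thesis unfolding one of_real_eq_0_iff by simp
  qed
  have "(M (-z) has_field_derivative (1 - cnj z * z)) (at 0)"
    unfolding M_def Moebius_function_def by (auto intro!: derivative_eq_intros simp: algebra_simps)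
  moreover have "(\<phi> has_field_derivative deriv \<phi> z) (at (M (-z) 0))"
    unfolding M0 by (rule holomorphic_derivI[OF hol _ z]) simp
  ultimately have 1: "((\<lambda>w. \<phi> (M (-z) w)) has_field_derivative deriv \<phi> z * (1 - cnj z * z)) (at 0)"
    by (intro DERIV_chain2)
  have "(M a has_field_derivative 1 / (1 - cnj a * a)) (at a)"
    unfolding M_def Moebius_function_def using ne[OF a]
    by (auto intro!: derivative_eq_intros simp: divide_simps power2_eq_square)
  then have "(M a has_field_derivative 1 / (1 - cnj a * a)) (at (\<phi> (M (-z) 0)))"
    by (simp add: M0 a_def)
  from DERIV_chain2[OF this 1]
  have "deriv F 0 = 1 / (1 - cnj a * a) * (deriv \<phi> z * (1 - cnj z * z))"
    unfolding F_def by (rule DERIV_imp_deriv)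
  moreover have "norm (deriv F 0) \<le> 1"
  proof (rule Schwarz_Lemma(2)[OF holF, of 0])
    show "F 0 = 0" using Ma by (simp add: F_def M0 a_def)
    show "norm (F w) < 1" if "norm w < 1" for w
      using that M(2)[OF nz] M(2)[OF a] lt by (auto simp: F_def)
  qed simp
  moreover have nrm: "norm (1 - cnj c * c) = 1 - (norm c)\<^sup>2" if "norm c < 1" for c
  proof -
    have "1 - (norm c)\<^sup>2 \<ge> 0" using that by (simp add: power_le_one)
    then show ?thesis unfolding one norm_of_real by simp
  qed
  moreover have "1 - (norm a)\<^sup>2 > 0" using a by (simp add: abs_square_less_1)
  moreover have "norm (1 / (1 - cnj a * a) * (deriv \<phi> z * (1 - cnj z * z)))
      = norm (deriv \<phi> z) * (1 - (norm z)\<^sup>2) / (1 - (norm a)\<^sup>2)"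
    unfolding norm_mult norm_divide using nrm[OF a] nrm[of z] z by simp
  ultimately have "norm (deriv \<phi> z) * (1 - (norm z)\<^sup>2) / (1 - (norm a)\<^sup>2) \<le> 1"
    by metis
  with \<open>1 - (norm a)\<^sup>2 > 0\<close> show ?thesis
    by (simp add: a_def pos_divide_le_eq)
qed

text \<open>
  With \<open>r = \<bar>z\<bar>\<close> and \<open>s = \<bar>a\<bar>\<close>, Schwarz--Pick reduces the claim to
  \<open>3 s (1 - r\<^sup>2) + r (1 - s\<^sup>2) \<le> (2 s + 1) (1 - r\<^sup>2 s\<^sup>2)\<close>. Both sides agree at \<open>s = 1\<close>; splitting off
  the factor \<open>1 - s\<close> from the difference leaves a sum of nonnegative terms.
\<close>

lemma Schwarz_Pick_consequence:
  fixes a d z :: complex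
  assumes a: "norm a \<le> 1" and z: "norm z < 1"
    and sp: "norm d * (1 - (norm z)\<^sup>2) \<le> 1 - (norm a)\<^sup>2"
  shows "norm (3 * a + z * d) * (1 - (norm z)\<^sup>2) \<le> (2 * norm a + 1) * (1 - (norm z * norm a)\<^sup>2)"
proof -
  define r where "r = norm z"
  define s where "s = norm a"
  have r: "0 \<le> r" "r < 1" and s: "0 \<le> s" "s \<le> 1" using a z by (auto simp: r_def s_def)
  have "norm (3 * a + z * d) \<le> 3 * s + r * norm d"
    using norm_triangle_ineq[of "3 * a" "z * d"] by (simp add: norm_mult r_def s_def)
  then have "norm (3 * a + z * d) * (1 - r\<^sup>2) \<le> (3 * s + r * norm d) * (1 - r\<^sup>2)"
    using r by (intro mult_right_mono) (auto simp: power_le_one)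
  also have "\<dots> = 3 * s * (1 - r\<^sup>2) + r * (norm d * (1 - r\<^sup>2))"
    by (simp add: algebra_simps)
  also have "\<dots> \<le> 3 * s * (1 - r\<^sup>2) + r * (1 - s\<^sup>2)"
    using sp r by (intro add_left_mono mult_left_mono) (auto simp: r_def s_def)
  also have "\<dots> = (2 * s + 1) * (1 - (r * s)\<^sup>2)
      - (1 - s) * ((1 - r) * (1 - s * r) + 2 * s * r\<^sup>2 + 2 * s\<^sup>2 * r\<^sup>2)"
    by (simp add: algebra_simps power2_eq_square)
  also have "\<dots> \<le> (2 * s + 1) * (1 - (r * s)\<^sup>2)"
  proof -
    have "s * r \<le> 1" using r s by (simp add: mult_le_one)
    then have "0 \<le> (1 - s) * ((1 - r) * (1 - s * r) + 2 * s * r\<^sup>2 + 2 * s\<^sup>2 * r\<^sup>2)"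
      using r s by (intro mult_nonneg_nonneg add_nonneg_nonneg) auto
    then show ?thesis by simp
  qed
  finally show ?thesis by (simp add: r_def s_def)
qed

text \<open>
  The identity behind this is \<open>\<bar>1 - z\<^sup>2 a\<bar>\<^sup>2 - \<bar>cnj z - z a\<bar>\<^sup>2 = (1 - \<bar>z\<bar>\<^sup>2) (1 - \<bar>z a\<bar>\<^sup>2)\<close>; after
  multiplication by \<open>\<bar>1 - z\<^sup>2 a\<bar>\<^sup>2\<close> a common factor \<open>2 (1 - \<bar>z\<bar>\<^sup>2)\<close> cancels. It is applied with
  \<open>a = \<phi>(z)\<close> and \<open>d = \<phi>'(z)\<close>.
\<close>

lemma condition_iff:
  fixes a d z :: complex
  assumes z: "norm z < 1" and w: "1 - z\<^sup>2 * a \<noteq> 0"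
  shows "norm (- 2 * (3 * a + z * d) / (1 - z\<^sup>2 * a)\<^sup>2) * (1 - (norm z)\<^sup>2)\<^sup>2
        + 2 * (2 * norm a + 1) * (norm ((cnj z - z * a) / (1 - z\<^sup>2 * a)))\<^sup>2 \<le> 2 * (2 * norm a + 1)
      \<longleftrightarrow> norm (3 * a + z * d) * (1 - (norm z)\<^sup>2) \<le> (2 * norm a + 1) * (1 - (norm z * norm a)\<^sup>2)"
    (is "?L \<longleftrightarrow> ?R")
proof -
  define W where "W = (norm (1 - z\<^sup>2 * a))\<^sup>2"
  define V where "V = (norm (cnj z - z * a))\<^sup>2"
  define t where "t = 1 - (norm z)\<^sup>2"
  define c where "c = 2 * norm a + 1"
  define B where "B = norm (3 * a + z * d)"
  have WV: "W - V = t * (1 - (norm z * norm a)\<^sup>2)"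
    unfolding W_def V_def t_def power_mult_distrib cmod_power2
    by (simp add: algebra_simps power2_eq_square)
  have pos: "W > 0" "t > 0"
    using z w by (auto simp: W_def t_def abs_square_less_1)
  have "?L \<longleftrightarrow> 2 * B / W * t\<^sup>2 + 2 * c * (V / W) \<le> 2 * c"
    unfolding B_def W_def V_def t_def c_def norm_mult norm_divide norm_power power_divide
    by simp
  also have "\<dots> \<longleftrightarrow> 2 * (B * t\<^sup>2 + c * V) \<le> 2 * (c * W)"
    using pos by (simp add: field_simps)
  also have "\<dots> \<longleftrightarrow> B * t\<^sup>2 \<le> c * (W - V)"
    unfolding mult_le_cancel_left_pos[OF zero_less_numeral] by (auto simp: algebra_simps)
  also have "\<dots> \<longleftrightarrow> t * (B * t) \<le> t * (c * (1 - (norm z * norm a)\<^sup>2))"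
    unfolding WV by (simp add: power2_eq_square mult_ac)
  also have "\<dots> \<longleftrightarrow> ?R"
    using pos(2) by (simp add: B_def c_def t_def)
  finally show ?thesis .
qed

section \<open>The Schwarzian criterion\<close>

lemma remove_sings_eq_continuous:
  assumes "\<And>w. w \<in> ball 0 1 - {0} \<Longrightarrow> h w = k w" and "z \<in> ball 0 1" "isCont k z"
  shows "(h \<longlongrightarrow> k z) (at z)" "remove_sings h z = k z"
proof -
  have "\<forall>\<^sub>F w in at z. w \<in> ball 0 1 - {z}"
    by (rule eventually_at_in_open) (use assms in auto)
  moreover have "\<forall>\<^sub>F w in at z. w \<noteq> 0"
    by (cases "z = 0") (auto intro: eventually_neq_at_within)
  ultimately have "\<forall>\<^sub>F w in at z. k w = h w"
    by eventually_elim (use assms(1) in auto)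
  moreover have "(k \<longlongrightarrow> k z) (at z)" using assms(3) by (simp add: isCont_def)
  ultimately show "(h \<longlongrightarrow> k z) (at z)" by (rule Lim_transform_eventually[rotated])
  then show "remove_sings h z = k z" by (rule remove_sings_eqI)
qed

context
  fixes f q p :: "complex \<Rightarrow> complex"
  assumes q: "q holomorphic_on ball 0 1" and p: "p holomorphic_on ball 0 1"
    and q': "\<And>z. z \<in> ball 0 1 \<Longrightarrow> deriv q z = z * p z"
    and f': "\<And>z. z \<in> ball 0 1 - {0} \<Longrightarrow> deriv f z = - exp (q z) / z\<^sup>2"
begin

lemma second_deriv_over_deriv:
  assumes z: "z \<in> ball 0 1 - {0}"
  shows "deriv (deriv f) z = deriv f z * (z * p z - 2 / z)" "deriv f z \<noteq> 0"
proof -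
  have "((\<lambda>w. - exp (q w) / w\<^sup>2) has_field_derivative
      - exp (q z) / z\<^sup>2 * (z * p z - 2 / z)) (at z)"
    using z q'[of z]
    by (auto intro!: derivative_eq_intros holomorphic_derivI[OF q] simp: field_simps power2_eq_square)
  then have "(deriv f has_field_derivative - exp (q z) / z\<^sup>2 * (z * p z - 2 / z)) (at z)"
    by (rule has_field_derivative_transform_within_open[of _ _ _ "ball 0 1 - {0}"]) (use z f' in auto)
  then show "deriv (deriv f) z = deriv f z * (z * p z - 2 / z)"
    unfolding f'[OF z] by (rule DERIV_imp_deriv)
  show "deriv f z \<noteq> 0" using z f'[OF z] by auto
qed

text \<open>
  The only possible pole of \<open>\<phi>\<close> at a point of the disk is a zero of \<open>z\<^sup>2 p(z) - 2 = - (1 + P(z))\<close>,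
  that is, a zero of \<open>f''\<close>.
\<close>

lemma phi_eq:
  assumes z: "z \<in> ball 0 1" "z\<^sup>2 * p z \<noteq> 2"
  shows "phi f z = p z / (z\<^sup>2 * p z - 2)" "\<not> is_pole (phi f) z"
proof -
  define \<psi> where "\<psi> w = p w / (w\<^sup>2 * p w - 2)" for w
  have contp: "isCont p w" if "w \<in> ball 0 1" for w
    using holomorphic_on_imp_continuous_on[OF p] that by (simp add: continuous_on_eq_continuous_at)
  have eq: "(w * deriv (deriv f) w + 2 * deriv f w) / (w ^ 3 * deriv (deriv f) w) = \<psi> w"
    if w: "w \<in> ball 0 1 - {0}" for w
  proof -
    have "w * deriv (deriv f) w + 2 * deriv f w = deriv f w * w\<^sup>2 * p w"
      using w unfolding second_deriv_over_deriv(1)[OF w]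
      by (simp add: field_simps power2_eq_square)
    moreover have "w ^ 3 * deriv (deriv f) w = deriv f w * w\<^sup>2 * (w\<^sup>2 * p w - 2)"
      using w unfolding second_deriv_over_deriv(1)[OF w]
      by (simp add: field_simps power2_eq_square power3_eq_cube)
    ultimately show ?thesis
      using w second_deriv_over_deriv(2)[OF w] by (simp add: \<psi>_def)
  qed
  have phi: "phi f w = \<psi> w" if "w \<in> ball 0 1" "w\<^sup>2 * p w \<noteq> 2" for w
    unfolding phi_def
    by (rule remove_sings_eq_continuous(2)[OF eq that(1)])
       (use that contp[OF that(1)] in \<open>auto simp: \<psi>_def[abs_def] intro!: continuous_intros\<close>)
  then show "phi f z = p z / (z\<^sup>2 * p z - 2)" using z by (simp add: \<psi>_def)
  have cont: "isCont (\<lambda>w. w\<^sup>2 * p w) z" using contp[OF z(1)] by (intro continuous_intros)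
  then have "\<forall>\<^sub>F w in at z. w\<^sup>2 * p w \<noteq> 2"
    unfolding isCont_def using z(2) by (rule tendsto_imp_eventually_ne)
  moreover have "\<forall>\<^sub>F w in at z. w \<in> ball 0 1 - {z}"
    by (rule eventually_at_in_open) (use z in auto)
  ultimately have "\<forall>\<^sub>F w in at z. \<psi> w = phi f w"
    by eventually_elim (use phi in auto)
  moreover have "(\<psi> \<longlongrightarrow> \<psi> z) (at z)"
  proof -
    have "isCont \<psi> z"
      using z contp[OF z(1)] unfolding \<psi>_def[abs_def] by (intro continuous_intros) auto
    then show ?thesis by (simp add: isCont_def)
  qed
  ultimately have "(phi f \<longlongrightarrow> \<psi> z) (at z)" by (rule Lim_transform_eventually[rotated])
  then show "\<not> is_pole (phi f) z"
    unfolding is_pole_def using not_tendsto_and_filterlim_at_infinity at_neq_bot by blast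
qed

lemma Schwarzian_eq:
  assumes z: "z \<in> ball 0 1"
  shows "Schwarzian f z = 3 * p z + z * deriv p z - z\<^sup>2 * (p z)\<^sup>2 / 2"
  unfolding Schwarzian_def
proof (rule remove_sings_eq_continuous(2)[OF _ z])
  fix w :: complex assume w: "w \<in> ball 0 1 - {0}"
  have quot: "deriv (deriv f) x / deriv f x = x * p x - 2 / x" if "x \<in> ball 0 1 - {0}" for x
    using second_deriv_over_deriv[OF that] by simp
  have "((\<lambda>x. x * p x - 2 / x) has_field_derivative p w + w * deriv p w + 2 / w\<^sup>2) (at w)"
    using w by (auto intro!: derivative_eq_intros holomorphic_derivI[OF p] simp: power2_eq_square)
  then have "((\<lambda>x. deriv (deriv f) x / deriv f x) has_field_derivative p w + w * deriv p w + 2 / w\<^sup>2) (at w)"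
    by (rule has_field_derivative_transform_within_open[of _ _ _ "ball 0 1 - {0}"]) (use w quot in auto)
  then have D: "deriv (\<lambda>x. deriv (deriv f) x / deriv f x) w = p w + w * deriv p w + 2 / w\<^sup>2"
    by (rule DERIV_imp_deriv)
  then show "deriv (\<lambda>x. deriv (deriv f) x / deriv f x) w - 1 / 2 * (deriv (deriv f) w / deriv f w)\<^sup>2
      = 3 * p w + w * deriv p w - w\<^sup>2 * (p w)\<^sup>2 / 2"
    unfolding D quot[OF w] using w by (simp add: field_simps power2_eq_square)
next
  have "continuous_on (ball 0 1) (\<lambda>w. 3 * p w + w * deriv p w - w\<^sup>2 * (p w)\<^sup>2 / 2)"
    by (intro holomorphic_on_imp_continuous_on holomorphic_intros p holomorphic_deriv) auto
  then show "isCont (\<lambda>w. 3 * p w + w * deriv p w - w\<^sup>2 * (p w)\<^sup>2 / 2) z"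
    using z by (simp add: continuous_on_eq_continuous_at)
qed

lemma criterion_iff:
  defines "\<psi> \<equiv> \<lambda>z. p z / (z\<^sup>2 * p z - 2)"
  assumes z: "z \<in> ball 0 1" "z\<^sup>2 * p z \<noteq> 2"
  shows "norm (Schwarzian f z) * (1 - (norm z)\<^sup>2)\<^sup>2
         + 2 * (2 * norm (phi f z) + 1) * (norm (Phi f z))\<^sup>2 \<le> 2 * (2 * norm (phi f z) + 1)
     \<longleftrightarrow> norm (3 * \<psi> z + z * deriv \<psi> z) * (1 - (norm z)\<^sup>2) \<le> (2 * norm (\<psi> z) + 1) * (1 - (norm z * norm (\<psi> z))\<^sup>2)"
proof -
  define c where "c = z\<^sup>2 * p z - 2"
  have c: "c \<noteq> 0" using z by (simp add: c_def)
  have "(\<psi> has_field_derivative (deriv p z * c - p z * (2 * z * p z + z\<^sup>2 * deriv p z)) / c\<^sup>2) (at z)"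
    using z unfolding \<psi>_def c_def
    by (auto intro!: derivative_eq_intros holomorphic_derivI[OF p] simp: power2_eq_square)
  then have d: "deriv \<psi> z = (deriv p z * c - p z * (2 * z * p z + z\<^sup>2 * deriv p z)) / c\<^sup>2"
    by (rule DERIV_imp_deriv)
  have \<psi>: "\<psi> z = p z / c" by (simp add: \<psi>_def c_def)
  have w: "1 - z\<^sup>2 * \<psi> z = - 2 / c"
    using c by (simp add: \<psi> divide_simps) (simp add: c_def)
  have "3 * \<psi> z + z * deriv \<psi> z = (3 * p z * c + z * deriv p z * c - z * p z * (2 * z * p z + z\<^sup>2 * deriv p z)) / c\<^sup>2"
    unfolding d \<psi> using c by (simp add: field_simps power2_eq_square)
  moreover have "3 * p z * c + z * deriv p z * c - z * p z * (2 * z * p z + z\<^sup>2 * deriv p z)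
     = - 2 * (3 * p z + z * deriv p z - z\<^sup>2 * (p z)\<^sup>2 / 2)"
    by (simp add: c_def algebra_simps power2_eq_square)
  ultimately have "Schwarzian f z = - 2 * (3 * \<psi> z + z * deriv \<psi> z) / (1 - z\<^sup>2 * \<psi> z)\<^sup>2"
    unfolding w Schwarzian_eq[OF z(1)] using c by (simp add: power_divide)
  moreover have "phi f z = \<psi> z" using phi_eq(1)[OF z] by (simp add: \<psi>_def)
  moreover have "1 - z\<^sup>2 * \<psi> z \<noteq> 0" using w c by simp
  ultimately show ?thesis
    using condition_iff[of z "\<psi> z" "deriv \<psi> z"] z(1) unfolding Phi_def by simp
qed

end

text \<open>
  With \<open>c = z\<^sup>2 p(z) = 1 - P(z)\<close>, the quotient is \<open>z\<^sup>2 \<phi>(z)\<close>: the Cayley transform takes the right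
  half-plane to the unit disk.
\<close>

lemma norm_div_diff_2_iff:
  fixes c :: complex
  assumes "c \<noteq> 2"
  shows "norm (c / (c - 2)) \<le> 1 \<longleftrightarrow> Re (1 - c) \<ge> 0" "norm (c / (c - 2)) < 1 \<longleftrightarrow> Re (1 - c) > 0"
proof -
  have sq: "(norm (c - 2))\<^sup>2 = (norm c)\<^sup>2 + 4 * Re (1 - c)"
    unfolding cmod_power2 by (simp add: algebra_simps power2_eq_square)
  have "norm c \<le> norm (c - 2) \<longleftrightarrow> Re (1 - c) \<ge> 0"
    using power_mono_iff[of "norm c" "norm (c - 2)" 2] by (auto simp: sq)
  moreover have "norm c < norm (c - 2) \<longleftrightarrow> Re (1 - c) > 0"
    using power_mono_iff[of "norm (c - 2)" "norm c" 2] by (auto simp: sq)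
  ultimately show "norm (c / (c - 2)) \<le> 1 \<longleftrightarrow> Re (1 - c) \<ge> 0" "norm (c / (c - 2)) < 1 \<longleftrightarrow> Re (1 - c) > 0"
    using assms by (simp_all add: norm_divide divide_le_eq_1)
qed

theorem theorem3:
  fixes f :: "complex \<Rightarrow> complex"
  assumes "normalized_pole_at_0 f"
    and "\<forall>z\<in>ball 0 1 - {0}. deriv f z \<noteq> 0"
  shows "f \<in> Co0 \<longleftrightarrow>
    (\<forall>z\<in>ball 0 1. \<not> is_pole (phi f) z \<longrightarrow>
       norm (Schwarzian f z) * (1 - (norm z)\<^sup>2)\<^sup>2
         + 2 * (2 * norm (phi f z) + 1) * (norm (Phi f z))\<^sup>2
       \<le> 2 * (2 * norm (phi f z) + 1))"
proof -
  obtain g where g: "g holomorphic_on ball 0 1" and fg: "\<And>z. z \<in> ball 0 1 - {0} \<Longrightarrow> f z = 1 / z + g z"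
    using normalized_pole_split[OF assms(1)] by blast
  have f: "f holomorphic_on ball 0 1 - {0}" using assms(1) by (simp add: normalized_pole_at_0_def)
  have nz: "deriv f z \<noteq> 0" if "z \<in> ball 0 1 - {0}" for z using assms(2) that by blast
  obtain q p where q: "q holomorphic_on ball 0 1" and p: "p holomorphic_on ball 0 1"
    and q': "\<And>z. z \<in> ball 0 1 \<Longrightarrow> deriv q z = z * p z"
    and f': "\<And>z. z \<in> ball 0 1 - {0} \<Longrightarrow> deriv f z = - exp (q z) / z\<^sup>2"
    using deriv_eq_minus_exp_over_square[OF g fg nz] by metis
  define \<psi> where "\<psi> = (\<lambda>z. p z / (z\<^sup>2 * p z - 2))"
  define bound where "bound z \<longleftrightarrow> norm (3 * \<psi> z + z * deriv \<psi> z) * (1 - (norm z)\<^sup>2)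
      \<le> (2 * norm (\<psi> z) + 1) * (1 - (norm z * norm (\<psi> z))\<^sup>2)" for z
  have crit: "norm (Schwarzian f z) * (1 - (norm z)\<^sup>2)\<^sup>2
         + 2 * (2 * norm (phi f z) + 1) * (norm (Phi f z))\<^sup>2 \<le> 2 * (2 * norm (phi f z) + 1)
      \<longleftrightarrow> bound z"
    and no_pole: "\<not> is_pole (phi f) z" if "z \<in> ball 0 1" "z\<^sup>2 * p z \<noteq> 2" for z
    unfolding bound_def \<psi>_def
    by (rule criterion_iff[OF q p _ _ that] phi_eq(2)[OF q p _ _ that]; rule q' f'; assumption)+
  have P: "1 - z * deriv q z = 1 - z\<^sup>2 * p z" if "z \<in> ball 0 1" for z
    using q'[OF that] by (simp add: power2_eq_square)
  have sq\<psi>: "z\<^sup>2 * \<psi> z = z\<^sup>2 * p z / (z\<^sup>2 * p z - 2)" for z by (simp add: \<psi>_def)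
  have hol\<psi>: "\<psi> holomorphic_on ball 0 1" if "\<And>z. z \<in> ball 0 1 \<Longrightarrow> z\<^sup>2 * p z \<noteq> 2"
    unfolding \<psi>_def using that by (intro holomorphic_intros p) auto
  show ?thesis
  proof
    assume "f \<in> Co0"
    then have inj: "inj_on f (ball 0 1 - {0})" and conv: "convex (- f ` (ball 0 1 - {0}))"
      by (auto simp: Co0_def)
    have Re: "Re (1 - z\<^sup>2 * p z) \<ge> 0" if z: "z \<in> ball 0 1" for z
    proof (cases "z = 0")
      case False
      then have zD: "z \<in> ball 0 1 - {0}" using z by auto
      show ?thesis
        unfolding P[OF z, symmetric]
      proof (rule angular_speed_nonneg[OF f q _ zD])
        show "Re ((f w - f z) / (z * deriv f z)) \<ge> 0" if "norm w = norm z" for w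
          using curve_on_one_side_of_tangent_if_convex_complement[OF f g _ inj conv zD that] fg by blast
      qed (rule f')
    qed simp
    then have ne: "z\<^sup>2 * p z \<noteq> 2" if "z \<in> ball 0 1" for z using that[THEN Re] by force
    have \<psi>1: "norm (\<psi> z) \<le> 1" if "z \<in> ball 0 1" for z
      by (rule norm_le_1_of_power_mult[OF hol\<psi>[OF ne] _ that, of 2])
         (use Re ne norm_div_diff_2_iff(1) in \<open>auto simp: sq\<psi> simp del: minus_complex.sel\<close>)
    show "\<forall>z\<in>ball 0 1. \<not> is_pole (phi f) z \<longrightarrow>
       norm (Schwarzian f z) * (1 - (norm z)\<^sup>2)\<^sup>2
         + 2 * (2 * norm (phi f z) + 1) * (norm (Phi f z))\<^sup>2
       \<le> 2 * (2 * norm (phi f z) + 1)"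
    proof (intro ballI impI)
      fix z :: complex assume z: "z \<in> ball 0 1"
      have "bound z"
        unfolding bound_def
        using Schwarz_Pick_consequence[OF \<psi>1[OF z] _ Schwarz_Pick[OF hol\<psi>[OF ne] \<psi>1 z]] z by simp
      then show "norm (Schwarzian f z) * (1 - (norm z)\<^sup>2)\<^sup>2
         + 2 * (2 * norm (phi f z) + 1) * (norm (Phi f z))\<^sup>2
       \<le> 2 * (2 * norm (phi f z) + 1)"
        using crit[OF z ne[OF z]] by blast
    qed
  next
    assume cond: "\<forall>z\<in>ball 0 1. \<not> is_pole (phi f) z \<longrightarrow>
       norm (Schwarzian f z) * (1 - (norm z)\<^sup>2)\<^sup>2
         + 2 * (2 * norm (phi f z) + 1) * (norm (Phi f z))\<^sup>2
       \<le> 2 * (2 * norm (phi f z) + 1)"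
    have le1: "norm (z * \<psi> z) \<le> 1" if z: "z \<in> ball 0 1" "z\<^sup>2 * p z \<noteq> 2" for z
    proof -
      have "bound z"
        using cond z(1) no_pole[OF z] crit[OF z] by blast
      moreover have "0 \<le> norm (3 * \<psi> z + z * deriv \<psi> z) * (1 - (norm z)\<^sup>2)"
        using z by (intro mult_nonneg_nonneg) (auto simp: power_le_one)
      ultimately have "0 \<le> (2 * norm (\<psi> z) + 1) * (1 - (norm z * norm (\<psi> z))\<^sup>2)"
        unfolding bound_def by linarith
      then have "0 \<le> 1 - (norm z * norm (\<psi> z))\<^sup>2"
        using norm_ge_zero[of "\<psi> z"] by (simp add: zero_le_mult_iff)
      then show ?thesis by (simp add: norm_mult abs_square_le_1)
    qed
    \<comment> \<open>At a pole of \<open>\<phi>\<close> the bound \<open>\<bar>z p(z)\<bar> \<le> \<bar>z\<^sup>2 p(z) - 2\<bar>\<close> would persist in the limit and force \<open>z p(z) = 0\<close>.\<close>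
    have ne: "z\<^sup>2 * p z \<noteq> 2" if z: "z \<in> ball 0 1" for z
    proof
      assume eq: "z\<^sup>2 * p z = 2"
      define d where "d w = w\<^sup>2 * p w - 2" for w
      have hold: "d holomorphic_on ball 0 1" unfolding d_def by (intro holomorphic_intros p)
      obtain r where r: "r > 0" "ball z r \<subseteq> ball 0 1" "\<And>w. w \<in> ball z r - {z} \<Longrightarrow> d w \<noteq> 0"
        using isolated_zeros[OF hold _ _ z, of 0] eq by (auto simp: d_def)
      have "\<forall>\<^sub>F w in at z. norm (w * p w) \<le> norm (d w)"
      proof -
        have "\<forall>\<^sub>F w in at z. w \<in> ball z r - {z}"
          by (rule eventually_at_in_open) (use r in auto)
        then show ?thesis
        proof eventually_elim
          case (elim w)
          then have "d w \<noteq> 0" "w \<in> ball 0 1" using r by auto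
          then show ?case
            using le1[of w] by (simp add: \<psi>_def d_def norm_mult norm_divide field_simps)
        qed
      qed
      moreover have contp: "isCont p z" and contd: "isCont d z"
        using p hold z by (auto simp: continuous_on_eq_continuous_at dest!: holomorphic_on_imp_continuous_on)
      then have "((\<lambda>w. norm (w * p w)) \<longlongrightarrow> norm (z * p z)) (at z)" "((\<lambda>w. norm (d w)) \<longlongrightarrow> norm (d z)) (at z)"
        unfolding isCont_def by (auto intro!: tendsto_intros)
      ultimately have "norm (z * p z) \<le> norm (d z)"
        by (intro tendsto_le[of "at z"]) auto
      then have "z * p z = 0" using eq by (simp add: d_def)
      then show False using eq by auto
    qed
    have \<psi>1: "norm (\<psi> z) \<le> 1" if "z \<in> ball 0 1" for z
      by (rule norm_le_1_of_power_mult[OF hol\<psi>[OF ne] _ that, of 1]) (use le1 ne in auto)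
    have pos: "Re (1 - z * deriv q z) > 0" if z: "z \<in> ball 0 1" for z
    proof -
      have "norm (z\<^sup>2 * \<psi> z) < 1"
      proof -
        have "norm (z\<^sup>2 * \<psi> z) \<le> (norm z)\<^sup>2 * 1"
          unfolding norm_mult norm_power using \<psi>1[OF z] by (intro mult_left_mono) auto
        also have "\<dots> < 1" using z by (simp add: abs_square_less_1)
        finally show ?thesis .
      qed
      then show ?thesis
        unfolding P[OF z] sq\<psi> norm_div_diff_2_iff(2)[OF ne[OF z]] .
    qed
    have tangent: "Re ((f z - f z0) / (z0 * deriv f z0)) > 0"
    if "z0 \<in> ball 0 1 - {0}" "norm z = norm z0" "z \<noteq> z0" for z0 z
    by (rule curve_on_one_side_of_tangent[OF f q _ _ that]) (rule f' pos, assumption)+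
    have inj: "inj_on f (ball 0 1 - {0})"
    proof (rule inj_on_if_inj_on_circles[OF f g])
      fix z w :: complex assume "z \<in> ball 0 1 - {0}" "norm w = norm z" "w \<noteq> z"
      from tangent[OF this] show "f w \<noteq> f z" by auto
    qed (rule fg nz, assumption)+
    have "convex (- f ` (ball 0 1 - {0}))"
    proof (rule convex_complement_if_curves_on_one_side[OF f g _ _ inj])
      fix z0 z :: complex assume "z0 \<in> ball 0 1 - {0}" "norm z = norm z0"
      then show "Re ((f z - f z0) / (z0 * deriv f z0)) \<ge> 0"
        using tangent[of z0 z] by (cases "z = z0") auto
    qed (rule fg nz, assumption)+
    with inj assms(1) show "f \<in> Co0" by (simp add: Co0_def)
  qed
qed

end
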